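(* Let $L$ be a pentagonal linkage charged by $(q_1,q_2,t,q_4,s)$ at its vertices $A_1,\dots,A_5$, where $q_1,q_2,q_4>0$ are fixed, with effective Coulomb potential $$E_{s,t}=\frac{q_1q_4}{|A_1A_4|}+\frac{q_2q_4}{|A_2A_4|}+\frac{q_1t}{|A_1A_3|}+\frac{q_2s}{|A_2A_5|}+\frac{st}{|A_3A_5|}.$$ Then for any starting configuration $P_0\in M^C(L)$ and any target configuration $P_1\in M^C(L)$ there exist a continuous path $\tau\mapsto(s(\tau),t(\tau))\in(\mathbb{R}_{>0})^2$, $\tau\in[0,1]$, and a continuous path $\tau\mapsto P(\tau)\in M^C(L)$ with $P(0)=P_0$, $P(1)=P_1$, such that for every $\tau$ the configuration $P(\tau)$ is the point of global minimum of $E_{s(\tau),t(\tau)}$ on $M(L)$.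
   Context: A pentagonal linkage $L$ is given by side lengths $a_1,\dots,a_5>0$; $M(L)$ is the set of planar 5-gons $(A_1,\dots,A_5)$ with $|A_iA_{i+1}|=a_i$ (indices mod 5) modulo all isometries of $\mathbb{R}^2$. $M^C(L)$ is the set of strictly convex configurations (convex pentagon $A_1\dots A_5$ in this cyclic order, no angle equal to $\pi$). *)

theory Defs
  imports "HOL-Analysis.Analysis"
begin

text \<open>A planar pentagon is represented by its vertices A_1..A_5 as P 0, ..., P 4
  (points of the plane, modelled as complex numbers); values P i for i >= 5 are irrelevant.\<close>

type_synonym pentagon = "nat \<Rightarrow> complex"

definition linkage_configs :: "(nat \<Rightarrow> real) \<Rightarrow> pentagon set" where
  "linkage_configs a = {P. \<forall>i<5. dist (P i) (P ((i + 1) mod 5)) = a i}"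

text \<open>Two pentagons represent the same point of M(L) iff they differ by an isometry of the plane.\<close>
definition congruent_pent :: "pentagon \<Rightarrow> pentagon \<Rightarrow> bool" where
  "congruent_pent P Q \<longleftrightarrow>
     (\<exists>f :: complex \<Rightarrow> complex. (\<forall>x y. dist (f x) (f y) = dist x y) \<and> (\<forall>i<5. Q i = f (P i)))"

definition cross2 :: "complex \<Rightarrow> complex \<Rightarrow> real" where
  "cross2 u v = Im (cnj u * v)"

definition strictly_convex_pent :: "pentagon \<Rightarrow> bool" where
  "strictly_convex_pent P \<longleftrightarrow>
     (\<forall>i<5. \<forall>j<5. j \<noteq> i \<and> j \<noteq> (i + 1) mod 5 \<longrightarrow>
        cross2 (P ((i + 1) mod 5) - P i) (P j - P i) > 0) \<or>
     (\<forall>i<5. \<forall>j<5. j \<noteq> i \<and> j \<noteq> (i + 1) mod 5 \<longrightarrow>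
        cross2 (P ((i + 1) mod 5) - P i) (P j - P i) < 0)"

definition convex_configs :: "(nat \<Rightarrow> real) \<Rightarrow> pentagon set" where
  "convex_configs a = {P \<in> linkage_configs a. strictly_convex_pent P}"

text \<open>Effective Coulomb potential E_{s,t} (indices shifted by one: A_k = P (k-1)).\<close>
definition energy :: "real \<Rightarrow> real \<Rightarrow> real \<Rightarrow> real \<Rightarrow> real \<Rightarrow> pentagon \<Rightarrow> real" where
  "energy q1 q2 q4 s t P =
     q1 * q4 / dist (P 0) (P 3) + q2 * q4 / dist (P 1) (P 3) + q1 * t / dist (P 0) (P 2)
     + q2 * s / dist (P 1) (P 4) + s * t / dist (P 2) (P 4)"

text \<open>The energy is finite iff none of the charged pairs coincide (all charges are positive,
  so a coincidence gives E = +infinity).\<close>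
definition finite_energy :: "pentagon \<Rightarrow> bool" where
  "finite_energy P \<longleftrightarrow> P 0 \<noteq> P 3 \<and> P 1 \<noteq> P 3 \<and> P 0 \<noteq> P 2 \<and> P 1 \<noteq> P 4 \<and> P 2 \<noteq> P 4"

definition is_global_min ::
  "(nat \<Rightarrow> real) \<Rightarrow> real \<Rightarrow> real \<Rightarrow> real \<Rightarrow> real \<Rightarrow> real \<Rightarrow> pentagon \<Rightarrow> bool" where
  "is_global_min a q1 q2 q4 s t P \<longleftrightarrow>
     P \<in> linkage_configs a \<and> finite_energy P \<and>
     (\<forall>Q \<in> linkage_configs a. finite_energy Q \<longrightarrow>
        energy q1 q2 q4 s t P \<le> energy q1 q2 q4 s t Q \<and>
        (energy q1 q2 q4 s t Q = energy q1 q2 q4 s t P \<longrightarrow> congruent_pent P Q))"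

end

theory Submission
  imports Defs
begin

text \<open>
  For a convex pentagon the equations saying that the Coulomb forces along the diagonals can be
  balanced by forces along the sides reduce to a quadratic equation for s with exactly one positive
  root, so every convex configuration is an equilibrium for charges s, t depending continuously on it.
  The resulting stress is positive on the sides and negative on the diagonals, hence its quadratic
  form is positive semidefinite (Connelly); as q/d is a strictly convex function of the squared
  length d^2, such an equilibrium is the unique global minimum.

  It remains to join two convex configurations inside the space of convex configurations. In terms of
  the squared diagonals X, Y from one vertex, all constraints except convexity at that vertex cut out a
  convex set that is closed under the coordinatewise maximum, and the angle at that vertex decreases
  in X and in Y. So both configurations are joined by segments to their coordinatewise maximum.
\<close>

text \<open>Balance of forces at five vertices gives ten scalar equations. Three of them follow from
  the others, because internal forces have no resultant and no torque. The seven unknowns are the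
  five side stresses and the two charges. The side stresses can be eliminated linearly, which leaves
  two equations in s, t and the product s t. The solution is an explicit formula in the
  configuration, so the charges inherit continuity from the path. The tangent to r -> q / sqrt r at
  r = d^2 has slope -q / (2 d^3). This is the origin of the stress -q / d^3 on a diagonal of length
  d with charge product q. The obstacle in joining two configurations is the angle at the chosen
  vertex: it is a sum of three arccosines and is not linear in X and Y. It is controlled only along
  segments on which neither diagonal shrinks. The maximum serves as meeting point because it is
  reached from both ends by such segments.\<close>

definition orient :: "pentagon \<Rightarrow> nat \<Rightarrow> nat \<Rightarrow> nat \<Rightarrow> real" where
  "orient P i j k = cross2 (P j - P i) (P k - P i)"

text \<open>All ten triples are listed so that the sign of every orientation is directly available.
  This is the counterclockwise case; the clockwise one is its complex conjugate.\<close>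

definition pos_convex :: "pentagon \<Rightarrow> bool" where
  "pos_convex P \<longleftrightarrow> (\<forall>i<5. \<forall>j<5. \<forall>k<5. i < j \<and> j < k \<longrightarrow> orient P i j k > 0)"

lemma cross2_expand: "cross2 u v = Re u * Im v - Im u * Re v"
  by (simp add: cross2_def)

lemma orient_expand:
  "orient P i j k = (Re (P j) - Re (P i)) * (Im (P k) - Im (P i)) - (Im (P j) - Im (P i)) * (Re (P k) - Re (P i))"
  by (simp add: orient_def cross2_expand)

lemma all_less_5_iff: "(\<forall>i<5. Q i) \<longleftrightarrow> Q 0 \<and> Q 1 \<and> Q 2 \<and> Q 3 \<and> Q (4::nat)"
  by (auto simp: less_Suc_eq numeral_eq_Suc)

lemma pos_convex_iff:
  "pos_convex P \<longleftrightarrow> orient P 0 1 2 > 0 \<and> orient P 0 1 3 > 0 \<and> orient P 0 1 4 > 0 \<and> orient P 0 2 3 > 0 \<and>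
    orient P 0 2 4 > 0 \<and> orient P 0 3 4 > 0 \<and> orient P 1 2 3 > 0 \<and> orient P 1 2 4 > 0 \<and>
    orient P 1 3 4 > 0 \<and> orient P 2 3 4 > 0"
  unfolding pos_convex_def all_less_5_iff by auto

lemma orient_rotate: "orient P j k i = orient P i j k"
  unfolding orient_expand by algebra

lemma orient_cnj: "orient (\<lambda>i. cnj (P i)) i j k = - orient P i j k"
  by (simp add: orient_expand) algebra

text \<open>Among any three of five cyclically arranged vertices two are adjacent. Every triple is
  therefore, up to rotation, a side together with a third vertex.\<close>

lemma pos_convex_sides:
  "pos_convex P \<longleftrightarrow> (\<forall>i<5. \<forall>j<5. j \<noteq> i \<and> j \<noteq> (i + 1) mod 5 \<longrightarrow> orient P i ((i + 1) mod 5) j > 0)"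
proof -
  have mods: "(0 + 1) mod 5 = (1::nat)" "(1 + 1) mod 5 = (2::nat)" "(2 + 1) mod 5 = (3::nat)"
    "(3 + 1) mod 5 = (4::nat)" "(4 + 1) mod 5 = (0::nat)"
    by simp_all
  have rot: "orient P 1 2 0 = orient P 0 1 2" "orient P 2 3 0 = orient P 0 2 3" "orient P 3 4 0 = orient P 0 3 4"
    "orient P 4 0 1 = orient P 0 1 4" "orient P 4 0 2 = orient P 0 2 4" "orient P 4 0 3 = orient P 0 3 4"
    "orient P 2 3 1 = orient P 1 2 3" "orient P 3 4 1 = orient P 1 3 4" "orient P 3 4 2 = orient P 2 3 4"
    using orient_rotate by metis+
  show ?thesis
    unfolding pos_convex_iff all_less_5_iff mods by (simp add: rot del: One_nat_def) blast
qed

lemma strictly_convex_pent_iff: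
  "strictly_convex_pent P \<longleftrightarrow> pos_convex P \<or> pos_convex (\<lambda>i. cnj (P i))"
  unfolding pos_convex_sides strictly_convex_pent_def orient_cnj by (simp add: orient_def)

section \<open>Equilibrium stresses\<close>

text \<open>The sum runs over ordered pairs, so each edge counts twice; hence the factors 2 in later
  expansions.\<close>

definition stress_form :: "nat \<Rightarrow> (nat \<Rightarrow> nat \<Rightarrow> real) \<Rightarrow> (nat \<Rightarrow> real) \<Rightarrow> real" where
  "stress_form n W x = (\<Sum>i<n. \<Sum>j<n. W i j * (x i - x j)\<^sup>2)"

text \<open>One coordinate of the equilibrium condition: \<open>x\<close> lies in the kernel of the
  weighted graph Laplacian of \<open>W\<close>.\<close>

definition balanced :: "nat \<Rightarrow> (nat \<Rightarrow> nat \<Rightarrow> real) \<Rightarrow> (nat \<Rightarrow> real) \<Rightarrow> bool" where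
  "balanced n W x \<longleftrightarrow> (\<forall>i<n. (\<Sum>j<n. W i j * (x j - x i)) = 0)"

lemma balanced_affine:
  assumes "balanced n W x" "balanced n W y"
  shows "balanced n W (\<lambda>i. \<alpha> + \<beta> * x i + \<gamma> * y i)"
proof -
  have "(\<Sum>j<n. W i j * ((\<alpha> + \<beta> * x j + \<gamma> * y j) - (\<alpha> + \<beta> * x i + \<gamma> * y i))) =
      \<beta> * (\<Sum>j<n. W i j * (x j - x i)) + \<gamma> * (\<Sum>j<n. W i j * (y j - y i))" for i
    by (simp add: sum_distrib_left sum.distrib [symmetric] algebra_simps)
  then show ?thesis
    using assms by (simp add: balanced_def)
qed

text \<open>A kernel vector is orthogonal to everything under the associated bilinear form. The fact
  \<open>bil\<close> is proved for arbitrary \<open>y\<close>, so it removes both the mixed term and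
  the square of \<open>z\<close>.\<close>

lemma stress_form_add_balanced:
  assumes sym: "\<And>i j. W i j = W j i" and z: "balanced n W z"
  shows "stress_form n W (\<lambda>i. x i + z i) = stress_form n W x"
proof -
  have bil: "(\<Sum>i<n. \<Sum>j<n. W i j * (y i - y j) * (z i - z j)) = 0" for y
  proof -
    have 1: "(\<Sum>i<n. \<Sum>j<n. W i j * y i * (z i - z j)) = 0"
    proof (rule sum.neutral, safe)
      fix i assume "i < n"
      have "(\<Sum>j<n. W i j * y i * (z i - z j)) = - y i * (\<Sum>j<n. W i j * (z j - z i))"
        by (simp add: sum_distrib_left algebra_simps)
      then show "(\<Sum>j<n. W i j * y i * (z i - z j)) = 0"
        using z \<open>i < n\<close> by (simp add: balanced_def)
    qed
    have 2: "(\<Sum>i<n. \<Sum>j<n. W i j * y j * (z i - z j)) = - (\<Sum>i<n. \<Sum>j<n. W i j * y i * (z i - z j))"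
      by (subst sum.swap) (simp add: sum_negf [symmetric] sym algebra_simps)
    have "(\<Sum>i<n. \<Sum>j<n. W i j * (y i - y j) * (z i - z j)) =
        (\<Sum>i<n. \<Sum>j<n. W i j * y i * (z i - z j)) - (\<Sum>i<n. \<Sum>j<n. W i j * y j * (z i - z j))"
      by (simp add: sum_subtractf [symmetric] algebra_simps)
    then show ?thesis using 1 2 by simp
  qed
  have "stress_form n W (\<lambda>i. x i + z i) = stress_form n W x
      + 2 * (\<Sum>i<n. \<Sum>j<n. W i j * (x i - x j) * (z i - z j)) + (\<Sum>i<n. \<Sum>j<n. W i j * (z i - z j) * (z i - z j))"
    by (simp add: stress_form_def sum_distrib_left sum.distrib [symmetric] power2_eq_square algebra_simps)
  then show ?thesis by (simp add: bil)
qed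

lemma stress_form_balanced_eq_0:
  assumes "\<And>i j. W i j = W j i" "balanced n W z"
  shows "stress_form n W z = 0"
  using stress_form_add_balanced [OF assms, of "\<lambda>_. 0"] by (simp add: stress_form_def)

lemma affine_interpolation:
  assumes "orient P i j k \<noteq> 0"
  obtains \<alpha> \<beta> \<gamma> where "\<And>l. l \<in> {i,j,k} \<Longrightarrow> x l = \<alpha> + \<beta> * Re (P l) + \<gamma> * Im (P l)"
proof -
  let ?D = "orient P i j k"
  define \<beta> where "\<beta> = ((x j - x i) * (Im (P k) - Im (P i)) - (Im (P j) - Im (P i)) * (x k - x i)) / ?D"
  define \<gamma> where "\<gamma> = ((Re (P j) - Re (P i)) * (x k - x i) - (x j - x i) * (Re (P k) - Re (P i))) / ?D"
  have "\<beta> * (Re (P j) - Re (P i)) + \<gamma> * (Im (P j) - Im (P i)) = x j - x i"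
    "\<beta> * (Re (P k) - Re (P i)) + \<gamma> * (Im (P k) - Im (P i)) = x k - x i"
    unfolding \<beta>_def \<gamma>_def using assms
    by (simp_all add: divide_simps) (simp_all add: orient_expand algebra_simps)
  then have "x l = (x i - \<beta> * Re (P i) - \<gamma> * Im (P i)) + \<beta> * Re (P l) + \<gamma> * Im (P l)"
    if "l \<in> {i,j,k}" for l
    using that by (auto simp: algebra_simps)
  then show thesis by (rule that)
qed

text \<open>Connelly's theorem on convex polygons with positive stresses on the sides and negative ones
  on the diagonals, for pentagons. Modulo the affine functions, which lie in the kernel, the form
  lives on the coordinates 0 and 3, and the equilibrium at these two vertices, measured against the
  line through 2 and 4, expresses the diagonal entries by the entries of known sign.\<close>

lemma stress_form_nonneg:
  assumes sym: "\<And>i j. W i j = W j i"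
    and bal: "balanced 5 W (\<lambda>i. Re (P i))" "balanced 5 W (\<lambda>i. Im (P i))"
    and pos: "pos_convex P"
    and W: "W 0 1 \<ge> 0" "W 0 3 \<le> 0" "W 1 3 \<le> 0"
  shows "stress_form 5 W x \<ge> 0"
proof -
  have "orient P 1 2 4 \<noteq> 0"
    using pos by (simp add: pos_convex_iff)
  then obtain \<alpha> \<beta> \<gamma> where abc: "\<And>l. l \<in> {1,2,4} \<Longrightarrow> x l = \<alpha> + \<beta> * Re (P l) + \<gamma> * Im (P l)"
    by (rule affine_interpolation [where x = x]) blast
  define y where "y i = x i - (\<alpha> + \<beta> * Re (P i) + \<gamma> * Im (P i))" for i
  have y0: "y 1 = 0" "y 2 = 0" "y 4 = 0"
    using abc by (simp_all add: y_def)
  have "stress_form 5 W (\<lambda>i. y i + (\<alpha> + \<beta> * Re (P i) + \<gamma> * Im (P i))) = stress_form 5 W y"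
    using sym bal by (intro stress_form_add_balanced balanced_affine) auto
  then have xy: "stress_form 5 W x = stress_form 5 W y"
    by (simp add: y_def)
  define l where "l i = orient P 2 4 i" for i
  have "l = (\<lambda>i. - (Re (P 4) - Re (P 2)) * Im (P 2) + (Im (P 4) - Im (P 2)) * Re (P 2)
      + (- (Im (P 4) - Im (P 2))) * Re (P i) + (Re (P 4) - Re (P 2)) * Im (P i))"
    by (auto simp: l_def orient_expand algebra_simps)
  then have ball: "balanced 5 W l"
    by (simp only:) (rule balanced_affine [OF bal])
  define m where "m = orient P 2 3 4"
  \<comment> \<open>Up to a constant factor \<open>l\<close> is the signed distance from the line
    through 2 and 4. Vertex 3 is cut off from 0 and 1 by this line, hence the opposite sign.\<close>
  have l: "l 2 = 0" "l 4 = 0" "l 3 = - m"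
    by (simp_all add: l_def m_def orient_expand algebra_simps)
  have lpos: "l 0 > 0" "l 1 > 0" "m > 0"
    using pos orient_rotate [of P 2 4 0] orient_rotate [of P 2 4 1]
    by (simp_all add: pos_convex_iff l_def m_def)
  have five: "{..<5} = {0,1,2,3,4::nat}" by auto
  define D0 where "D0 = W 0 1 + W 0 2 + W 0 3 + W 0 4"
  define D3 where "D3 = W 3 0 + W 3 1 + W 3 2 + W 3 4"
  have "(\<Sum>j<5. W 0 j * (l j - l 0)) = 0" "(\<Sum>j<5. W 3 j * (l j - l 3)) = 0"
    using ball by (simp_all add: balanced_def)
  then have D: "D0 * l 0 = W 0 1 * l 1 - W 0 3 * m" "D3 * m = - W 0 3 * l 0 - W 1 3 * l 1"
    using sym [of 3 0] sym [of 3 1]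
    by (simp_all add: five l D0_def D3_def algebra_simps)
  have "stress_form 5 W y = 2 * (D0 * (y 0)\<^sup>2 + D3 * (y 3)\<^sup>2 - 2 * W 0 3 * y 0 * y 3)"
    using sym [of 1 0] sym [of 2 0] sym [of 3 0] sym [of 4 0] sym [of 3 1] sym [of 3 2] sym [of 4 3]
    by (simp add: five stress_form_def y0 [simplified] D0_def D3_def power2_eq_square algebra_simps)
  \<comment> \<open>The factor \<open>l 0 * m\<close> is positive and clears the denominators of
    \<open>D0\<close> and \<open>D3\<close>. The three terms containing \<open>W 0 3\<close> then
    combine into a perfect square.\<close>
  then have "stress_form 5 W y * (l 0 * m) =
     2 * ((D0 * l 0) * m * (y 0)\<^sup>2 + (D3 * m) * l 0 * (y 3)\<^sup>2 - 2 * W 0 3 * (y 0 * m) * (y 3 * l 0))"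
    by algebra
  also have "\<dots> = 2 * (W 0 1 * l 1 * m * (y 0)\<^sup>2 + (- W 0 3) * (y 0 * m + y 3 * l 0)\<^sup>2 + (- W 1 3) * l 1 * l 0 * (y 3)\<^sup>2)"
    unfolding D by (simp add: power2_eq_square algebra_simps)
  also have "\<dots> \<ge> 0"
    using W lpos by (intro mult_nonneg_nonneg add_nonneg_nonneg) auto
  finally have "stress_form 5 W y * (l 0 * m) \<ge> 0" .
  moreover have "l 0 * m > 0"
    using lpos by (intro mult_pos_pos)
  ultimately show ?thesis
    unfolding xy zero_le_mult_iff by linarith
qed

text \<open>Used for the force at a vertex and its two sides: the cross product with one side
  removes the unknown stress on that side and leaves an equation for the stress on the
  other.\<close>

lemma cross2_cancel:
  assumes "cross2 z u = 0" "cross2 z v = 0" "cross2 u v \<noteq> 0"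
  shows "z = 0"
proof -
  have "Re z * cross2 u v = 0" "Im z * cross2 u v = 0"
    using assms(1,2) unfolding cross2_expand by algebra+
  then show ?thesis using assms(3) by (simp add: complex_eq_iff)
qed

text \<open>The edge weights solve the equilibrium at the vertices by Cramer's rule; the two hypotheses
  say that both endpoints of the edges 23 and 34 yield the same weight. The remaining
  consistency conditions follow since internal forces have no resultant and no torque.\<close>

lemma equilibrium_stress:
  assumes pos: "pos_convex P"
    and u: "u02 > 0" "u03 > 0" "u13 > 0" "u14 > 0" "u24 > 0"
    and e23: "(u02 * orient P 0 1 2 + u24 * orient P 1 2 4) / orient P 1 2 3
      = (u03 * orient P 0 3 4 + u13 * orient P 1 3 4) / orient P 2 3 4"
    and e34: "(u14 * orient P 0 1 4 + u24 * orient P 0 2 4) / orient P 0 3 4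
      = (u03 * orient P 0 2 3 + u13 * orient P 1 2 3) / orient P 2 3 4"
  obtains W where "\<And>i j. W i j = W j i" "balanced 5 W (\<lambda>i. Re (P i))" "balanced 5 W (\<lambda>i. Im (P i))"
    "W 0 1 \<ge> 0" "W 0 2 = - u02" "W 0 3 = - u03" "W 1 3 = - u13" "W 1 4 = - u14" "W 2 4 = - u24"
proof -
  note pos' = pos [unfolded pos_convex_iff]
  \<comment> \<open>Each side stress is read off at one endpoint by crossing with the other side
    there: \<open>w01\<close> at vertex 0, \<open>w12\<close> at vertex 2, \<open>w23\<close> and
    \<open>w34\<close> at vertex 3, \<open>w04\<close> at vertex 4.\<close>
  define w01 where "w01 = (u02 * orient P 0 2 4 + u03 * orient P 0 3 4) / orient P 0 1 4"
  define w12 where "w12 = (u02 * orient P 0 2 3 + u24 * orient P 2 3 4) / orient P 1 2 3"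
  define w23 where "w23 = (u03 * orient P 0 3 4 + u13 * orient P 1 3 4) / orient P 2 3 4"
  define w34 where "w34 = (u03 * orient P 0 2 3 + u13 * orient P 1 2 3) / orient P 2 3 4"
  define w04 where "w04 = (u14 * orient P 1 3 4 + u24 * orient P 2 3 4) / orient P 0 3 4"
  have w01: "w01 * orient P 0 1 4 = u02 * orient P 0 2 4 + u03 * orient P 0 3 4"
    and w12: "w12 * orient P 1 2 3 = u02 * orient P 0 2 3 + u24 * orient P 2 3 4"
    and w23: "w23 * orient P 2 3 4 = u03 * orient P 0 3 4 + u13 * orient P 1 3 4"
    and w34: "w34 * orient P 2 3 4 = u03 * orient P 0 2 3 + u13 * orient P 1 2 3"
    and w04: "w04 * orient P 0 3 4 = u14 * orient P 1 3 4 + u24 * orient P 2 3 4"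
    using pos' by (simp_all add: w01_def w12_def w23_def w34_def w04_def)
  \<comment> \<open>The same stresses read off at their other endpoints, 2 and 4; this is where the
    two compatibility hypotheses enter.\<close>
  have w23': "w23 * orient P 1 2 3 = u02 * orient P 0 1 2 + u24 * orient P 1 2 4"
    and w34': "w34 * orient P 0 3 4 = u14 * orient P 0 1 4 + u24 * orient P 0 2 4"
    unfolding w23_def w34_def e23 [symmetric] e34 [symmetric] using pos' by simp_all
  define c where "c r z = complex_of_real r * z" for r z
  define F0 where "F0 = c w01 (P 1 - P 0) + c w04 (P 4 - P 0) - c u02 (P 2 - P 0) - c u03 (P 3 - P 0)"
  define F1 where "F1 = c w01 (P 0 - P 1) + c w12 (P 2 - P 1) - c u13 (P 3 - P 1) - c u14 (P 4 - P 1)"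
  define F2 where "F2 = c w12 (P 1 - P 2) + c w23 (P 3 - P 2) - c u02 (P 0 - P 2) - c u24 (P 4 - P 2)"
  define F3 where "F3 = c w23 (P 2 - P 3) + c w34 (P 4 - P 3) - c u03 (P 0 - P 3) - c u13 (P 1 - P 3)"
  define F4 where "F4 = c w34 (P 3 - P 4) + c w04 (P 0 - P 4) - c u14 (P 1 - P 4) - c u24 (P 2 - P 4)"
  have F2: "F2 = 0"
  proof (rule cross2_cancel)
    show "cross2 F2 (P 1 - P 2) = 0"
      using w23' by (simp add: F2_def c_def cross2_expand orient_expand algebra_simps)
    show "cross2 F2 (P 3 - P 2) = 0"
      using w12 by (simp add: F2_def c_def cross2_expand orient_expand algebra_simps)
    show "cross2 (P 1 - P 2) (P 3 - P 2) \<noteq> 0"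
      using pos' by (simp add: cross2_expand orient_expand algebra_simps)
  qed
  have F3: "F3 = 0"
  proof (rule cross2_cancel)
    show "cross2 F3 (P 2 - P 3) = 0"
      using w34 by (simp add: F3_def c_def cross2_expand orient_expand algebra_simps)
    show "cross2 F3 (P 4 - P 3) = 0"
      using w23 by (simp add: F3_def c_def cross2_expand orient_expand algebra_simps)
    show "cross2 (P 2 - P 3) (P 4 - P 3) \<noteq> 0"
      using pos' by (simp add: cross2_expand orient_expand algebra_simps)
  qed
  have F4: "F4 = 0"
  proof (rule cross2_cancel)
    show "cross2 F4 (P 3 - P 4) = 0"
      using w04 by (simp add: F4_def c_def cross2_expand orient_expand algebra_simps)
    show "cross2 F4 (P 0 - P 4) = 0"
      using w34' by (simp add: F4_def c_def cross2_expand orient_expand algebra_simps)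
    show "cross2 (P 3 - P 4) (P 0 - P 4) \<noteq> 0"
      using pos' by (simp add: cross2_expand orient_expand algebra_simps)
  qed
  have resultant: "F0 + F1 + F2 + F3 + F4 = 0"
    by (simp add: F0_def F1_def F2_def F3_def F4_def c_def algebra_simps)
  have torque: "cross2 F0 (P 0) + cross2 F1 (P 1) + cross2 F2 (P 2) + cross2 F3 (P 3) + cross2 F4 (P 4) = 0"
    by (simp add: F0_def F1_def F2_def F3_def F4_def c_def cross2_expand algebra_simps)
  have F1: "F1 = - F0"
    using resultant F2 F3 F4 by (simp add: eq_neg_iff_add_eq_0 add.commute)
  \<comment> \<open>Since \<open>F1 = - F0\<close>, the torque identity says that \<open>F0\<close>
    is parallel to the side 01. The formula for \<open>w01\<close> gives parallelism to the side
    04.\<close>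
  have F0: "F0 = 0"
  proof (rule cross2_cancel)
    show "cross2 F0 (P 1 - P 0) = 0"
      using torque unfolding F1 F2 F3 F4 by (simp add: cross2_expand algebra_simps)
    show "cross2 F0 (P 4 - P 0) = 0"
      using w01 by (simp add: F0_def c_def cross2_expand orient_expand algebra_simps)
    show "cross2 (P 1 - P 0) (P 4 - P 0) \<noteq> 0"
      using pos' by (simp add: cross2_expand orient_expand algebra_simps)
  qed
  \<comment> \<open>Indexing the weights by unordered pairs makes the stress symmetric by
    construction.\<close>
  define V :: "nat set \<Rightarrow> real" where
    "V = (\<lambda>_. 0)({0,1} := w01, {1,2} := w12, {2,3} := w23, {3,4} := w34, {0,4} := w04,
      {0,2} := - u02, {0,3} := - u03, {1,3} := - u13, {1,4} := - u14, {2,4} := - u24)"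
  define W where "W i j = V {i, j}" for i j
  have sym: "W i j = W j i" for i j
    by (simp add: W_def insert_commute)
  have W: "W 0 1 = w01" "W 1 2 = w12" "W 2 3 = w23" "W 3 4 = w34" "W 0 4 = w04"
     "W 0 2 = - u02" "W 0 3 = - u03" "W 1 3 = - u13" "W 1 4 = - u14" "W 2 4 = - u24"
    by (simp_all add: W_def V_def doubleton_eq_iff)
  have W': "W 1 0 = w01" "W 2 1 = w12" "W 3 2 = w23" "W 4 3 = w34" "W 4 0 = w04"
     "W 2 0 = - u02" "W 3 0 = - u03" "W 3 1 = - u13" "W 4 1 = - u14" "W 4 2 = - u24"
    using W sym by metis+
  have five: "{..<5} = {0,1,2,3,4::nat}" by auto
  have "balanced 5 W (\<lambda>i. Re (P i))"
    using F0 F1 F2 F3 F4 unfolding balanced_def all_less_5_iff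
    by (simp add: five complex_eq_iff F0_def F1_def F2_def F3_def F4_def c_def W [simplified] W' [simplified])
  moreover have "balanced 5 W (\<lambda>i. Im (P i))"
    using F0 F1 F2 F3 F4 unfolding balanced_def all_less_5_iff
    by (simp add: five complex_eq_iff F0_def F1_def F2_def F3_def F4_def c_def W [simplified] W' [simplified])
  moreover have "W 0 1 \<ge> 0"
    using pos' u unfolding W w01_def by (intro divide_nonneg_nonneg add_nonneg_nonneg mult_nonneg_nonneg) auto
  ultimately show thesis
    using sym W by (intro that [of W]) auto
qed

section \<open>Global minimality\<close>

text \<open>The left-hand side is the tangent at d^2 of the convex function r -> c / sqrt r,
  evaluated at e^2. The explicit factor (d - e)^2 of the difference gives both the inequality and
  the equality case.\<close>

lemma inverse_tangent_bound:
  fixes d e :: real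
  assumes "c > 0" "d > 0" "e > 0"
  shows "c / d + c / d ^ 3 * (d\<^sup>2 - e\<^sup>2) / 2 \<le> c / e"
    and "c / d + c / d ^ 3 * (d\<^sup>2 - e\<^sup>2) / 2 = c / e \<longleftrightarrow> e = d"
proof -
  have eq: "c / e - (c / d + c / d ^ 3 * (d\<^sup>2 - e\<^sup>2) / 2) = c * ((d - e)\<^sup>2 * (2 * d + e)) / (2 * d ^ 3 * e)"
    using assms by (simp add: divide_simps) (simp add: power2_eq_square power3_eq_cube algebra_simps)
  have "c * ((d - e)\<^sup>2 * (2 * d + e)) / (2 * d ^ 3 * e) \<ge> 0"
    using assms by simp
  then show "c / d + c / d ^ 3 * (d\<^sup>2 - e\<^sup>2) / 2 \<le> c / e"
    using eq by simp
  have "c * ((d - e)\<^sup>2 * (2 * d + e)) / (2 * d ^ 3 * e) = 0 \<longleftrightarrow> e = d"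
    using assms by auto
  then show "c / d + c / d ^ 3 * (d\<^sup>2 - e\<^sup>2) / 2 = c / e \<longleftrightarrow> e = d"
    using eq by auto
qed

lemma stress_form_Re_Im:
  "stress_form n W (\<lambda>i. Re (P i)) + stress_form n W (\<lambda>i. Im (P i)) = (\<Sum>i<n. \<Sum>j<n. W i j * (dist (P i) (P j))\<^sup>2)"
  by (simp add: stress_form_def dist_norm cmod_power2 sum.distrib [symmetric] distrib_left)

lemma inner_eq_dist: "(x::'a::real_inner) \<bullet> y = ((norm x)\<^sup>2 + (norm y)\<^sup>2 - (dist x y)\<^sup>2) / 2"
  by (simp add: dist_norm dot_norm_neg)

text \<open>Both pentagons are moved so that vertex 0 is the origin and vertex 1 lies on the
  positive real axis. Equal Gram matrices then give equal real parts and equal products of imaginary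
  parts. So the imaginary parts agree up to one common sign, fixed by vertex 2, and this sign
  decides between a direct isometry and a reflection.\<close>

lemma congruent_pent_of_dist_eq:
  assumes dist: "\<And>i j. i < 5 \<Longrightarrow> j < 5 \<Longrightarrow> dist (Q i) (Q j) = dist (P i) (P j)"
    and nondeg: "orient P 0 1 2 \<noteq> 0"
  shows "congruent_pent P Q"
proof -
  define p where "p i = P i - P 0" for i
  define q where "q i = Q i - Q 0" for i
  have Q: "Q i = Q 0 + q i" for i
    by (simp add: q_def)
  define N where "N = norm (p 1)"
  have "p 1 \<noteq> 0"
    using nondeg by (auto simp: p_def orient_def cross2_def)
  then have N: "N > 0" by (simp add: N_def)
  have norm_eq: "norm (q i) = norm (p i)" if "i < 5" for i
    using dist [of i 0] that by (simp add: p_def q_def dist_norm)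
  have inner_eq: "q i \<bullet> q j = p i \<bullet> p j" if "i < 5" "j < 5" for i j
    using dist [of i j] norm_eq that by (simp add: inner_eq_dist) (simp add: p_def q_def dist_norm)
  define u where "u = p 1 / N"
  define v where "v = q 1 / N"
  have uv: "norm u = 1" "norm v = 1"
    using N norm_eq [of 1] by (simp_all add: u_def v_def N_def norm_divide)
  define x where "x i = cnj u * p i" for i
  define y where "y i = cnj v * q i" for i
  have uu: "u * cnj u = 1" "v * cnj v = 1"
    using uv by (simp_all add: complex_norm_square [symmetric])
  have px: "p i = u * x i" and qy: "q i = v * y i" for i
    using uu by (simp_all add: x_def y_def mult.assoc [symmetric])
  have gram: "x i \<bullet> x j = y i \<bullet> y j" if "i < 5" "j < 5" for i j
  proof -
    have "(w * a) \<bullet> (w * b) = a \<bullet> b" if "norm w = 1" for w a b :: complex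
    proof -
      have "(w * a) \<bullet> (w * b) = (norm w)\<^sup>2 * (a \<bullet> b)"
        unfolding cmod_power2 by (simp add: inner_complex_def power2_eq_square algebra_simps)
      then show ?thesis using that by simp
    qed
    then show ?thesis
      using inner_eq [OF that] uv unfolding px qy by simp
  qed
  have x1: "x 1 = N" and y1: "y 1 = N"
  proof -
    have "cnj z * z = (norm z)\<^sup>2" for z
      by (metis complex_norm_square mult.commute)
    then show "x 1 = N" "y 1 = N"
      using N norm_eq [of 1] by (simp_all add: x_def y_def u_def v_def N_def power2_eq_square)
  qed
  have Re_eq: "Re (x i) = Re (y i)" if "i < 5" for i
    using gram [of 1 i] that N unfolding x1 y1 by (simp add: inner_complex_def)
  have Im_eq: "Im (x i) * Im (x j) = Im (y i) * Im (y j)" if "i < 5" "j < 5" for i j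
    using gram [OF that] Re_eq that by (simp add: inner_complex_def)
  have Im_eq2: "Im (x i) * Im (x 2) = Im (y i) * Im (y 2)" if "i < 5" for i
    using Im_eq that by simp
  have "Im (x 2) \<noteq> 0"
  proof
    assume "Im (x 2) = 0"
    have "orient P 0 1 2 = (norm u)\<^sup>2 * cross2 (x 1) (x 2)"
      unfolding orient_def p_def [symmetric] px cmod_power2
      by (simp add: cross2_expand power2_eq_square algebra_simps)
    also have "\<dots> = 0"
      unfolding x1 using \<open>Im (x 2) = 0\<close> by (simp add: cross2_expand)
    finally show False using nondeg by simp
  qed
  moreover have "(Im (x 2))\<^sup>2 = (Im (y 2))\<^sup>2"
    using Im_eq [of 2 2] by (simp add: power2_eq_square)
  ultimately consider "Im (y 2) = Im (x 2)" | "Im (y 2) = - Im (x 2)"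
    by (auto simp: power2_eq_iff)
  then show ?thesis
  proof cases
    case 1
    have yx: "y i = x i" if "i < 5" for i
    proof -
      have "Im (y i) * Im (x 2) = Im (x i) * Im (x 2)"
        using Im_eq2 [OF that] unfolding 1 by linarith
      then show ?thesis
        using \<open>Im (x 2) \<noteq> 0\<close> Re_eq that by (simp add: complex_eq_iff)
    qed
    define f where "f z = Q 0 + v * (cnj u * (z - P 0))" for z
    have "f z - f w = v * (cnj u * (z - w))" for z w
      by (simp add: f_def algebra_simps)
    then have "dist (f z) (f w) = dist z w" for z w
      using uv by (simp add: dist_norm norm_mult)
    moreover have "Q i = f (P i)" if "i < 5" for i
      by (subst Q) (simp add: f_def x_def p_def qy yx that)
    ultimately show ?thesis
      unfolding congruent_pent_def by blast
  next
    case 2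
    have yx: "y i = cnj (x i)" if "i < 5" for i
    proof -
      have "Im (y i) * Im (x 2) = - Im (x i) * Im (x 2)"
        using Im_eq2 [OF that] unfolding 2 by linarith
      then have "Im (y i) = - Im (x i)"
        using \<open>Im (x 2) \<noteq> 0\<close> mult_right_cancel by blast
      then show ?thesis
        using Re_eq that by (simp add: complex_eq_iff)
    qed
    define f where "f z = Q 0 + v * (u * cnj (z - P 0))" for z
    have "f z - f w = v * (u * cnj (z - w))" for z w
      by (simp add: f_def algebra_simps)
    then have "dist (f z) (f w) = dist z w" for z w
      using uv by (simp add: dist_norm norm_mult flip: complex_cnj_diff)
    moreover have "Q i = f (P i)" if "i < 5" for i
      by (subst Q) (simp add: f_def x_def p_def qy yx that)
    ultimately show ?thesis
      unfolding congruent_pent_def by blast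
  qed
qed

lemma pos_convex_finite_energy:
  assumes "pos_convex P"
  shows "finite_energy P"
  using assms unfolding finite_energy_def pos_convex_iff orient_expand by auto

lemma linkage_configs_iff:
  "P \<in> linkage_configs a \<longleftrightarrow> dist (P 0) (P 1) = a 0 \<and> dist (P 1) (P 2) = a 1 \<and> dist (P 2) (P 3) = a 2 \<and>
    dist (P 3) (P 4) = a 3 \<and> dist (P 0) (P 4) = a 4"
proof -
  have mods: "(0 + 1) mod 5 = (1::nat)" "(1 + 1) mod 5 = (2::nat)" "(2 + 1) mod 5 = (3::nat)"
    "(3 + 1) mod 5 = (4::nat)" "(4 + 1) mod 5 = (0::nat)"
    by simp_all
  show ?thesis
    unfolding linkage_configs_def mem_Collect_eq all_less_5_iff mods by (auto simp: dist_commute)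
qed

text \<open>Replacing each term of the energy of \<open>Q\<close> by its tangent at \<open>P\<close>
  bounds it from below. The sum of the tangents exceeds the energy of \<open>P\<close> by a positive
  multiple of the stress energy difference \<open>T Q - T P\<close>, where \<open>T Q\<close> is
  nonnegative and \<open>T P\<close> vanishes by equilibrium. Equality forces equality in every
  tangent bound, so all diagonals agree, and with the sides all mutual distances.\<close>

lemma equilibrium_is_global_min:
  assumes P: "P \<in> linkage_configs a" "pos_convex P"
    and pos: "q1 > 0" "q2 > 0" "q4 > 0" "s > 0" "t > 0"
    and sym: "\<And>i j. W i j = W j i"
    and bal: "balanced 5 W (\<lambda>i. Re (P i))" "balanced 5 W (\<lambda>i. Im (P i))"
    and W: "W 0 1 \<ge> 0" "W 0 2 = - (q1 * t / (dist (P 0) (P 2)) ^ 3)" "W 0 3 = - (q1 * q4 / (dist (P 0) (P 3)) ^ 3)"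
      "W 1 3 = - (q2 * q4 / (dist (P 1) (P 3)) ^ 3)" "W 1 4 = - (q2 * s / (dist (P 1) (P 4)) ^ 3)"
      "W 2 4 = - (s * t / (dist (P 2) (P 4)) ^ 3)"
  shows "is_global_min a q1 q2 q4 s t P"
proof -
  have fin: "finite_energy P"
    using P by (simp add: pos_convex_finite_energy)
  have "energy q1 q2 q4 s t P \<le> energy q1 q2 q4 s t Q \<and>
    (energy q1 q2 q4 s t Q = energy q1 q2 q4 s t P \<longrightarrow> congruent_pent P Q)"
    if Q: "Q \<in> linkage_configs a" "finite_energy Q" for Q
  proof -
    define d where "d i j = dist (P i) (P j)" for i j
    define e where "e i j = dist (Q i) (Q j)" for i j
    define T where "T R = (\<Sum>i<5. \<Sum>j<5. W i j * (dist (R i) (R j))\<^sup>2)" for R :: pentagon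
    define G where "G c i j = c / d i j + c / d i j ^ 3 * ((d i j)\<^sup>2 - (e i j)\<^sup>2) / 2" for c i j
    have G_eq: "G c i j = c / d i j + (- (c / d i j ^ 3) * (e i j)\<^sup>2 - - (c / d i j ^ 3) * (d i j)\<^sup>2) / 2" for c i j
      by (simp add: G_def right_diff_distrib)
    have G_le: "G c i j \<le> c / e i j" and G_eq_iff: "G c i j = c / e i j \<longleftrightarrow> e i j = d i j"
      if "c > 0" "d i j > 0" "e i j > 0" for c i j
      using inverse_tangent_bound [OF that] by (simp_all add: G_def)
    have dpos: "d 0 2 > 0" "d 0 3 > 0" "d 1 3 > 0" "d 1 4 > 0" "d 2 4 > 0"
      using fin by (simp_all add: finite_energy_def d_def)
    have epos: "e 0 2 > 0" "e 0 3 > 0" "e 1 3 > 0" "e 1 4 > 0" "e 2 4 > 0"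
      using Q by (simp_all add: finite_energy_def e_def)
    have edges: "e 0 1 = d 0 1" "e 1 2 = d 1 2" "e 2 3 = d 2 3" "e 3 4 = d 3 4" "e 0 4 = d 0 4"
      using P Q by (simp_all add: linkage_configs_iff d_def e_def)
    have W03: "W 0 3 \<le> 0" "W 1 3 \<le> 0"
      using W pos by simp_all
    have "T Q \<ge> 0"
      unfolding T_def stress_form_Re_Im [symmetric]
      by (intro add_nonneg_nonneg stress_form_nonneg [OF sym bal P(2) W(1) W03])
    moreover have "T P = 0"
      unfolding T_def stress_form_Re_Im [symmetric] by (simp add: stress_form_balanced_eq_0 [OF sym] bal)
    moreover have T: "T R = 2 * (W 0 1 * (dist (R 0) (R 1))\<^sup>2 + W 1 2 * (dist (R 1) (R 2))\<^sup>2 + W 2 3 * (dist (R 2) (R 3))\<^sup>2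
       + W 3 4 * (dist (R 3) (R 4))\<^sup>2 + W 0 4 * (dist (R 0) (R 4))\<^sup>2 + W 0 2 * (dist (R 0) (R 2))\<^sup>2 + W 0 3 * (dist (R 0) (R 3))\<^sup>2
       + W 1 3 * (dist (R 1) (R 3))\<^sup>2 + W 1 4 * (dist (R 1) (R 4))\<^sup>2 + W 2 4 * (dist (R 2) (R 4))\<^sup>2)" for R
    proof -
      have five: "{..<5} = {0,1,2,3,4::nat}" by auto
      show ?thesis
        unfolding T_def five
        using sym [of 1 0] sym [of 2 1] sym [of 3 2] sym [of 4 3] sym [of 4 0]
          sym [of 2 0] sym [of 3 0] sym [of 3 1] sym [of 4 1] sym [of 4 2]
        by (simp add: dist_commute)
    qed
    \<comment> \<open>Both configurations have the same side lengths, so the side terms cancel and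
      only the diagonals remain.\<close>
    ultimately have stress: "W 0 2 * (e 0 2)\<^sup>2 + W 0 3 * (e 0 3)\<^sup>2 + W 1 3 * (e 1 3)\<^sup>2 + W 1 4 * (e 1 4)\<^sup>2 + W 2 4 * (e 2 4)\<^sup>2
      \<ge> W 0 2 * (d 0 2)\<^sup>2 + W 0 3 * (d 0 3)\<^sup>2 + W 1 3 * (d 1 3)\<^sup>2 + W 1 4 * (d 1 4)\<^sup>2 + W 2 4 * (d 2 4)\<^sup>2"
      using edges unfolding T e_def d_def by simp
    have regroup: "p1 + p2 + p3 + p4 + p5 \<le> p1 + (y1 - x1) / 2 + (p2 + (y2 - x2) / 2) + (p3 + (y3 - x3) / 2)
        + (p4 + (y4 - x4) / 2) + (p5 + (y5 - x5) / 2)"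
      if "x3 + x1 + x2 + x4 + x5 \<le> y3 + y1 + y2 + y4 + y5" for p1 p2 p3 p4 p5 x1 x2 x3 x4 x5 y1 y2 y3 y4 y5 :: real
      using that by (simp add: field_simps)
    have G: "energy q1 q2 q4 s t P \<le> G (q1 * q4) 0 3 + G (q2 * q4) 1 3 + G (q1 * t) 0 2 + G (q2 * s) 1 4 + G (s * t) 2 4"
      unfolding energy_def G_eq d_def [symmetric] W(2-) [folded d_def, symmetric] by (rule regroup [OF stress])
    have E: "energy q1 q2 q4 s t Q = q1 * q4 / e 0 3 + q2 * q4 / e 1 3 + q1 * t / e 0 2 + q2 * s / e 1 4 + s * t / e 2 4"
      by (simp add: energy_def e_def)
    have le: "G (q1 * q4) 0 3 \<le> q1 * q4 / e 0 3" "G (q2 * q4) 1 3 \<le> q2 * q4 / e 1 3" "G (q1 * t) 0 2 \<le> q1 * t / e 0 2"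
      "G (q2 * s) 1 4 \<le> q2 * s / e 1 4" "G (s * t) 2 4 \<le> s * t / e 2 4"
      by (simp_all add: G_le dpos epos pos del: One_nat_def)
    have "congruent_pent P Q" if "energy q1 q2 q4 s t Q = energy q1 q2 q4 s t P"
    proof -
      have eq: "G (q1 * q4) 0 3 = q1 * q4 / e 0 3" "G (q2 * q4) 1 3 = q2 * q4 / e 1 3" "G (q1 * t) 0 2 = q1 * t / e 0 2"
        "G (q2 * s) 1 4 = q2 * s / e 1 4" "G (s * t) 2 4 = s * t / e 2 4"
        using le G that unfolding E by linarith+
      have diag: "e 0 3 = d 0 3" "e 1 3 = d 1 3" "e 0 2 = d 0 2" "e 1 4 = d 1 4" "e 2 4 = d 2 4"
        using eq by (simp_all add: G_eq_iff dpos epos pos del: One_nat_def)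
      have sym': "e i j = e j i" "d i j = d j i" for i j
        by (simp_all add: d_def e_def dist_commute)
      have ii: "e i i = d i i" for i
        by (simp add: d_def e_def)
      have "\<forall>i<5. \<forall>j<5. e i j = d i j"
        unfolding all_less_5_iff using edges diag
        by (simp add: ii sym' [of 1 0] sym' [of 2 0] sym' [of 3 0] sym' [of 4 0] sym' [of 2 1] sym' [of 3 1]
            sym' [of 4 1] sym' [of 3 2] sym' [of 4 2] sym' [of 4 3] del: One_nat_def)
      then show ?thesis
        using P by (intro congruent_pent_of_dist_eq) (auto simp: d_def e_def pos_convex_iff)
    qed
    then show ?thesis using G le unfolding E by linarith
  qed
  then show ?thesis
    using P fin unfolding is_global_min_def by blast
qed

section \<open>The equations for the charges\<close>

definition solve_s :: "real \<Rightarrow> real \<Rightarrow> real \<Rightarrow> real \<Rightarrow> real \<Rightarrow> real \<Rightarrow> real" where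
  "solve_s a b c a' b' c' =
    (let B = a * a' + b' * c - b * c' in (sqrt (B\<^sup>2 + 4 * (a' * b) * (a * c')) - B) / (2 * (a' * b)))"

text \<open>Eliminating t from the two equations leaves a quadratic equation for s, whose leading and
  constant coefficients have opposite signs; \<open>solve_s\<close> is its positive root.\<close>

lemma solve_s:
  fixes a b c a' b' c' :: real
  assumes "a > 0" "b > 0" "c > 0" "a' > 0" "b' > 0" "c' > 0"
  defines "s \<equiv> solve_s a b c a' b' c'"
  defines "t \<equiv> c / (a + s * b)"
  shows "s > 0" "t > 0" "t * a + s * t * b = c" "s * a' + s * t * b' = c'"
proof -
  define B where "B = a * a' + b' * c - b * c'"
  have s_def: "s = (sqrt (B\<^sup>2 + 4 * (a' * b) * (a * c')) - B) / (2 * (a' * b))"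
    by (simp add: assms(7) solve_s_def Let_def B_def)
  have AC: "4 * (a' * b) * (a * c') > 0" "a' * b > 0"
    using assms(1-6) by simp_all
  have "B \<le> \<bar>B\<bar>" by simp
  also have "\<bar>B\<bar> = sqrt (B\<^sup>2)" by simp
  also have "\<dots> < sqrt (B\<^sup>2 + 4 * (a' * b) * (a * c'))"
    using AC by (intro real_sqrt_less_mono) simp
  finally show s: "s > 0"
    using AC by (simp add: s_def)
  then have pos: "a + s * b > 0"
    using assms(1,2) by (intro add_pos_pos mult_pos_pos)
  then show "t > 0"
    using assms(3) by (simp add: t_def)
  have t: "t * (a + s * b) = c"
    using pos by (simp add: t_def)
  then show "t * a + s * t * b = c"
    by (simp add: algebra_simps)
  have "(2 * (a' * b) * s + B)\<^sup>2 = B\<^sup>2 + 4 * (a' * b) * (a * c')"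
    using AC by (simp add: s_def)
  then have "4 * (a' * b) * ((a' * b) * s\<^sup>2 + B * s) = 4 * (a' * b) * (a * c')"
    by (simp add: power2_eq_square algebra_simps)
  moreover have "4 * (a' * b) \<noteq> 0"
    using AC(2) by linarith
  ultimately have "(a' * b) * s\<^sup>2 + B * s = a * c'"
    using mult_left_cancel by blast
  then have "s * a' * (a + s * b) + s * b' * c = c' * (a + s * b)"
    by (simp add: B_def power2_eq_square algebra_simps)
  moreover have "(s * a' + s * t * b') * (a + s * b) = s * a' * (a + s * b) + s * b' * (t * (a + s * b))"
    by (simp add: algebra_simps)
  ultimately have "(s * a' + s * t * b') * (a + s * b) = c' * (a + s * b)"
    by (simp add: t)
  then show "s * a' + s * t * b' = c'"
    using pos by simp
qed

section \<open>Triangles with given side lengths\<close>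

text \<open>All arguments are squared side lengths; the value is 16 times the squared area.\<close>

definition heron :: "real \<Rightarrow> real \<Rightarrow> real \<Rightarrow> real" where
  "heron A B C = 4 * B * C - (B + C - A)\<^sup>2"

text \<open>The law of cosines: the angle in question is the one opposite the side with square
  \<open>A\<close>, between the sides with squares \<open>B\<close> and \<open>C\<close>.\<close>

definition cos_angle :: "real \<Rightarrow> real \<Rightarrow> real \<Rightarrow> real" where
  "cos_angle A B C = (B + C - A) / (2 * sqrt B * sqrt C)"

lemma heron_permute: "heron A B C = heron C B A" "heron A B C = heron C A B"
  by (simp_all add: heron_def power2_eq_square algebra_simps)

lemma heron_cos_angle:
  assumes "B > 0" "C > 0"
  shows "heron A B C = 4 * B * C * (1 - (cos_angle A B C)\<^sup>2)"
  using assms by (simp add: heron_def cos_angle_def power_divide power_mult_distrib right_diff_distrib)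

lemma cos_angle_bounds:
  assumes "B > 0" "C > 0" "heron A B C > 0"
  shows "-1 < cos_angle A B C" "cos_angle A B C < 1"
proof -
  have "(cos_angle A B C)\<^sup>2 < 1"
    using assms mult_pos_pos [OF assms(1,2)] by (auto simp: heron_cos_angle zero_less_mult_iff)
  then show "-1 < cos_angle A B C" "cos_angle A B C < 1"
    by (auto simp: abs_square_less_1 abs_less_iff)
qed

text \<open>The expression factors as ((b + c)^2 - a^2) (a^2 - (b - c)^2). The two factors cannot
  both be negative since (b - c)^2 < (b + c)^2.\<close>

lemma heron_pos_iff:
  assumes "a > 0" "b > 0" "c > 0"
  shows "heron (a\<^sup>2) (b\<^sup>2) (c\<^sup>2) > 0 \<longleftrightarrow> \<bar>b - c\<bar> < a \<and> a < b + c"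
proof -
  have "heron (a\<^sup>2) (b\<^sup>2) (c\<^sup>2) = ((b + c)\<^sup>2 - a\<^sup>2) * (a\<^sup>2 - (b - c)\<^sup>2)"
    by (simp add: heron_def power2_eq_square algebra_simps)
  moreover have "(b - c)\<^sup>2 < (b + c)\<^sup>2"
    using assms by (simp add: power2_eq_square algebra_simps)
  moreover have "(b - c)\<^sup>2 < a\<^sup>2 \<longleftrightarrow> \<bar>b - c\<bar> < a"
    using abs_le_square_iff [of a "b - c"] assms by (simp add: not_le [symmetric])
  moreover have "a\<^sup>2 < (b + c)\<^sup>2 \<longleftrightarrow> a < b + c"
    using abs_le_square_iff [of "b + c" a] assms by (simp add: not_le [symmetric])
  ultimately show ?thesis
    by (auto simp: zero_less_mult_iff)
qed

text \<open>For a fixed third side the quadratic part in the other two squares is -(X -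
  Y)^2.\<close>

lemma heron_concave:
  assumes "0 \<le> u" "u \<le> 1" "c \<ge> 0"
  shows "(1 - u) * heron X Y c + u * heron X' Y' c \<le> heron ((1 - u) * X + u * X') ((1 - u) * Y + u * Y') c"
proof -
  have "heron ((1 - u) * X + u * X') ((1 - u) * Y + u * Y') c - ((1 - u) * heron X Y c + u * heron X' Y' c)
      = u * (1 - u) * ((X - Y) - (X' - Y'))\<^sup>2"
    by (simp add: heron_def power2_eq_square algebra_simps)
  also have "\<dots> \<ge> 0" using assms by simp
  finally show ?thesis by simp
qed

lemma heron_concave_pos:
  assumes "0 \<le> u" "u \<le> 1" "c \<ge> 0" "heron X Y c > 0" "heron X' Y' c > 0"
  shows "heron ((1 - u) * X + u * X') ((1 - u) * Y + u * Y') c > 0"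
proof -
  have "0 < (1 - u) * heron X Y c + u * heron X' Y' c"
    using assms by (cases "u = 0") (auto intro: add_nonneg_pos)
  then show ?thesis
    using heron_concave [OF assms(1-3)] by (rule less_le_trans)
qed

text \<open>Each triangle inequality for the new triangle follows from one of a given triangle by
  monotonicity: the bound on the side \<open>x'\<close> comes from the second triangle, those on
  \<open>y\<close> and \<open>d\<close> from the first.\<close>

lemma heron_join:
  assumes "X > 0" "Y > 0" "X' > 0" "Y' > 0" "c > 0" "X \<le> X'" "Y' \<le> Y"
    and "heron X Y c > 0" "heron X' Y' c > 0"
  shows "heron X' Y c > 0"
proof -
  define x y x' y' d where "x = sqrt X" "y = sqrt Y" "x' = sqrt X'" "y' = sqrt Y'" "d = sqrt c"
  note defs = this
  have eq: "X = x\<^sup>2" "Y = y\<^sup>2" "X' = x'\<^sup>2" "Y' = y'\<^sup>2" "c = d\<^sup>2"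
    and pos: "x > 0" "y > 0" "x' > 0" "y' > 0" "d > 0" and le: "x \<le> x'" "y' \<le> y"
    using assms by (simp_all add: defs)
  show ?thesis
    using assms(8,9) pos le unfolding eq by (simp add: heron_pos_iff abs_less_iff)
qed

text \<open>The identity \<open>sin (r + s) (1 + cos (r - s)) = (cos r + cos s) (sin r + sin s)\<close> turns
  the condition that two adjacent angles add up to less than a straight angle into a linear
  condition on their cosines.\<close>

lemma sum_cos_pos_iff:
  fixes c1 s1 c2 s2 :: real
  assumes "s1 > 0" "s2 > 0" "c1\<^sup>2 + s1\<^sup>2 = 1" "c2\<^sup>2 + s2\<^sup>2 = 1"
  shows "s1 * c2 + c1 * s2 > 0 \<longleftrightarrow> c1 + c2 > 0"
proof -
  have eq: "(s1 * c2 + c1 * s2) * (1 + (c1 * c2 + s1 * s2)) = (c1 + c2) * (s1 + s2)"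
    using assms(3,4) by algebra
  have "2 * (1 + (c1 * c2 + s1 * s2)) = (c1 + c2)\<^sup>2 + (s1 + s2)\<^sup>2"
    using assms(3,4) by algebra
  also have "\<dots> > 0" using assms by (simp add: add_nonneg_pos)
  finally have "1 + (c1 * c2 + s1 * s2) > 0" by simp
  then show ?thesis
    using eq assms(1,2) by (metis add_pos_pos zero_less_mult_pos2 mult_pos_pos)
qed

text \<open>If r and s are the angles from u to v and from v to w, both sides of the equivalence
  express that r + s is less than pi: the left one through sin (r + s), the right one through cos r
  + cos s.\<close>

lemma cross2_trans_pos_iff:
  assumes "cross2 u v > 0" "cross2 v w > 0"
  shows "cross2 u w > 0 \<longleftrightarrow> u \<bullet> v / norm u + v \<bullet> w / norm w > 0"
proof -
  have nz: "u \<noteq> 0" "v \<noteq> 0" "w \<noteq> 0"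
    using assms by (auto simp: cross2_def)
  define c1 s1 c2 s2 where "c1 = u \<bullet> v / (norm u * norm v)" "s1 = cross2 u v / (norm u * norm v)"
    "c2 = v \<bullet> w / (norm v * norm w)" "s2 = cross2 v w / (norm v * norm w)"
  note defs = this
  have lagrange: "(a \<bullet> b)\<^sup>2 + (cross2 a b)\<^sup>2 = (norm a * norm b)\<^sup>2" for a b :: complex
    by (simp add: cross2_expand inner_complex_def cmod_power2 power_mult_distrib) (simp add: power2_eq_square algebra_simps)
  have "c1\<^sup>2 + s1\<^sup>2 = 1" "c2\<^sup>2 + s2\<^sup>2 = 1"
    using nz by (simp_all add: defs power_divide add_divide_distrib [symmetric] lagrange)
  moreover have "s1 > 0" "s2 > 0"
    using assms nz by (simp_all add: defs)
  ultimately have *: "s1 * c2 + c1 * s2 > 0 \<longleftrightarrow> c1 + c2 > 0"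
    by (intro sum_cos_pos_iff)
  have "(norm v)\<^sup>2 * cross2 u w = cross2 u v * (v \<bullet> w) + (u \<bullet> v) * cross2 v w"
    by (simp add: cross2_expand inner_complex_def cmod_power2) (simp add: power2_eq_square algebra_simps)
  then have "s1 * c2 + c1 * s2 = cross2 u w / (norm u * norm w)"
    using nz by (simp add: defs divide_simps) (simp add: power2_eq_square algebra_simps)
  moreover have "c1 + c2 = (u \<bullet> v / norm u + v \<bullet> w / norm w) / norm v"
    using nz by (simp add: defs divide_simps)
  ultimately show ?thesis
    using * nz by (auto simp: zero_less_divide_iff mult_less_0_iff)
qed

section \<open>Triangle angles as functions of squared side lengths\<close>

definition angle :: "real \<Rightarrow> real \<Rightarrow> real \<Rightarrow> real" where
  "angle A B C = arccos (cos_angle A B C)"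

lemma angle_bounds:
  assumes "B > 0" "C > 0" "heron A B C > 0"
  shows "0 < angle A B C" "angle A B C < pi"
  using arccos_lt_bounded [OF cos_angle_bounds [OF assms]] by (simp_all add: angle_def)

lemma cos_angle_eq:
  assumes "B > 0" "C > 0" "heron A B C > 0"
  shows "cos (angle A B C) = cos_angle A B C"
  using cos_angle_bounds [OF assms] by (simp add: angle_def cos_arccos)

lemma law_of_cosines:
  assumes "B > 0" "C > 0" "heron A B C > 0"
  shows "A = B + C - 2 * sqrt B * sqrt C * cos (angle A B C)"
  using assms by (simp add: cos_angle_eq cos_angle_def)

lemma angle_unique:
  assumes "B > 0" "C > 0" "A = B + C - 2 * sqrt B * sqrt C * cos \<phi>" "0 \<le> \<phi>" "\<phi> \<le> pi"
  shows "angle A B C = \<phi>"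
  using assms by (simp add: angle_def cos_angle_def arccos_cos)

text \<open>In the formula (B + A - C) / sqrt (heron A B C) is the cotangent of the angle opposite
  the side with square C. With A fixed, each adjacent square thus contributes minus such a cotangent
  times half its logarithmic derivative.\<close>

lemma has_real_derivative_angle:
  assumes B: "(B has_real_derivative B') (at x)" and C: "(C has_real_derivative C') (at x)"
    and pos: "B x > 0" "C x > 0" "heron A (B x) (C x) > 0"
  shows "((\<lambda>x. angle A (B x) (C x)) has_real_derivative
    - ((B x + A - C x) / B x * B' + (C x + A - B x) / C x * C') / (2 * sqrt (heron A (B x) (C x)))) (at x)"
proof -
  define b c where "b = sqrt (B x)" "c = sqrt (C x)"
  note bc_def = this
  let ?h = "sqrt (heron A (B x) (C x))"
  let ?N = "(B x + A - C x) / B x * B' + (C x + A - B x) / C x * C'"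
  have sq: "B x = b * b" "C x = c * c" and bc: "b > 0" "c > 0"
    using pos by (simp_all add: bc_def)
  have db: "((\<lambda>x. sqrt (B x)) has_real_derivative B' / (2 * b)) (at x)"
    using DERIV_chain2 [OF DERIV_real_sqrt B] pos by (simp add: bc_def field_simps)
  have dc: "((\<lambda>x. sqrt (C x)) has_real_derivative C' / (2 * c)) (at x)"
    using DERIV_chain2 [OF DERIV_real_sqrt C] pos by (simp add: bc_def field_simps)
  have dN: "((\<lambda>x. B x + C x - A) has_real_derivative B' + C') (at x)"
    using DERIV_diff [OF DERIV_add [OF B C] DERIV_const] by simp
  have dD: "((\<lambda>x. 2 * sqrt (B x) * sqrt (C x)) has_real_derivative B' / b * c + C' / c * b) (at x)"
    using DERIV_mult [OF DERIV_cmult [OF db, of 2] dc] by (simp add: bc_def)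
  have "((\<lambda>x. cos_angle A (B x) (C x)) has_real_derivative
      ((B' + C') * (2 * b * c) - (B x + C x - A) * (B' / b * c + C' / c * b)) / ((2 * b * c) * (2 * b * c))) (at x)"
    unfolding cos_angle_def using DERIV_divide [OF dN dD] pos by (simp add: bc_def)
  also have "((B' + C') * (2 * b * c) - (B x + C x - A) * (B' / b * c + C' / c * b)) / ((2 * b * c) * (2 * b * c))
      = ?N / (4 * b * c)"
    unfolding sq using bc by (simp add: divide_simps) (simp add: algebra_simps)
  finally have "((\<lambda>x. cos_angle A (B x) (C x)) has_real_derivative ?N / (4 * b * c)) (at x)" .
  moreover have "sqrt (1 - (cos_angle A (B x) (C x))\<^sup>2) = ?h / (2 * b * c)"
    using pos by (simp add: heron_cos_angle real_sqrt_mult bc_def)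
  ultimately have "((\<lambda>x. arccos (cos_angle A (B x) (C x))) has_real_derivative
      inverse (- (?h / (2 * b * c))) * (?N / (4 * b * c))) (at x)"
    using DERIV_chain2 [where g = "\<lambda>x. cos_angle A (B x) (C x)", OF DERIV_arccos [OF cos_angle_bounds [OF pos]]]
    by (metis (no_types, lifting))
  moreover have "inverse (- (?h / (2 * b * c))) * (?N / (4 * b * c)) = - ?N / (2 * ?h)"
    using bc pos by (simp add: divide_simps)
  ultimately show ?thesis
    by (simp add: angle_def)
qed

section \<open>The region of convex configurations\<close>

text \<open>A convex pentagon is determined by the squares X and Y of the diagonals from the vertex 0 to
  the vertices 2 and 3. In these coordinates convexity at 2 and at 3 is linear, and only convexity
  at 0 refers to the sum of angles.\<close>

definition pre_region :: "(nat \<Rightarrow> real) \<Rightarrow> (real \<times> real) set" where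
  "pre_region a = {(X, Y). X > 0 \<and> Y > 0 \<and>
     heron X ((a 0)\<^sup>2) ((a 1)\<^sup>2) > 0 \<and> heron X Y ((a 2)\<^sup>2) > 0 \<and> heron Y ((a 4)\<^sup>2) ((a 3)\<^sup>2) > 0 \<and>
     (X + (a 1)\<^sup>2 - (a 0)\<^sup>2) / a 1 + (X + (a 2)\<^sup>2 - Y) / a 2 > 0 \<and>
     (Y + (a 2)\<^sup>2 - X) / a 2 + (Y + (a 3)\<^sup>2 - (a 4)\<^sup>2) / a 3 > 0}"

text \<open>The interior angle at vertex 0, cut by the two diagonals into angles of the three
  triangles of the fan.\<close>

definition angle_sum :: "(nat \<Rightarrow> real) \<Rightarrow> real \<times> real \<Rightarrow> real" where
  "angle_sum a z = angle ((a 1)\<^sup>2) ((a 0)\<^sup>2) (fst z) + angle ((a 2)\<^sup>2) (fst z) (snd z)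
     + angle ((a 3)\<^sup>2) (snd z) ((a 4)\<^sup>2)"

definition region :: "(nat \<Rightarrow> real) \<Rightarrow> (real \<times> real) set" where
  "region a = {z \<in> pre_region a. angle_sum a z < pi}"

text \<open>The \<open>heron\<close> conditions are superlevel sets of concave functions. The last
  two conditions are linear: they are the sum of the cosines of the two angles at vertex 2,
  multiplied by twice the diagonal 02, and the corresponding sum at vertex 3 for the diagonal
  03.\<close>

lemma convex_pre_region:
  assumes "a 1 > 0" "a 2 > 0" "a 3 > 0"
  shows "convex (pre_region a)"
proof (rule convexI)
  have lin: "0 < u * p + v * q" if "0 \<le> u" "0 \<le> v" "u + v = 1" "p > 0" "q > 0" for u v p q :: real
    using that by (cases "u = 0") (auto intro: add_pos_nonneg)
  fix z z' and u v :: real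
  assume z: "z \<in> pre_region a" "z' \<in> pre_region a" and uv: "0 \<le> u" "0 \<le> v" "u + v = 1"
  obtain X Y X' Y' where eq: "z = (X, Y)" "z' = (X', Y')"
    by (metis surj_pair)
  note z = z [unfolded eq pre_region_def mem_Collect_eq prod.case]
  have u: "u = 1 - v" "v \<le> 1" using uv by simp_all
  have const: "u * c + v * c = c" for c
    unfolding u(1) by (simp add: algebra_simps)
  have h: "heron (u * X + v * X') (u * Y + v * Y') c > 0"
    if "c \<ge> 0" "heron X Y c > 0" "heron X' Y' c > 0" for X Y X' Y' c
    unfolding u(1) using that uv u(2) by (intro heron_concave_pos)
  have "heron (u * X + v * X') ((a 0)\<^sup>2) ((a 1)\<^sup>2) > 0"
    using h [of "(a 1)\<^sup>2" X "(a 0)\<^sup>2" X' "(a 0)\<^sup>2"] z by (simp add: const)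
  moreover have "heron (u * Y + v * Y') ((a 4)\<^sup>2) ((a 3)\<^sup>2) > 0"
    using h [of "(a 3)\<^sup>2" Y "(a 4)\<^sup>2" Y' "(a 4)\<^sup>2"] z by (simp add: const)
  moreover have "heron (u * X + v * X') (u * Y + v * Y') ((a 2)\<^sup>2) > 0"
    using h [of "(a 2)\<^sup>2" X Y X' Y'] z by simp
  moreover have "u * X + v * X' > 0" "u * Y + v * Y' > 0"
    using z lin uv by blast+
  moreover have "((u * X + v * X') + (a 1)\<^sup>2 - (a 0)\<^sup>2) / a 1 + ((u * X + v * X') + (a 2)\<^sup>2 - (u * Y + v * Y')) / a 2 > 0"
  proof -
    have "((u * X + v * X') + (a 1)\<^sup>2 - (a 0)\<^sup>2) / a 1 + ((u * X + v * X') + (a 2)\<^sup>2 - (u * Y + v * Y')) / a 2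
      = u * ((X + (a 1)\<^sup>2 - (a 0)\<^sup>2) / a 1 + (X + (a 2)\<^sup>2 - Y) / a 2)
      + v * ((X' + (a 1)\<^sup>2 - (a 0)\<^sup>2) / a 1 + (X' + (a 2)\<^sup>2 - Y') / a 2)"
      unfolding u(1) using assms by (simp add: divide_simps) (simp add: algebra_simps)
    then show ?thesis using lin [OF uv] z by simp
  qed
  moreover have "((u * Y + v * Y') + (a 2)\<^sup>2 - (u * X + v * X')) / a 2 + ((u * Y + v * Y') + (a 3)\<^sup>2 - (a 4)\<^sup>2) / a 3 > 0"
  proof -
    have "((u * Y + v * Y') + (a 2)\<^sup>2 - (u * X + v * X')) / a 2 + ((u * Y + v * Y') + (a 3)\<^sup>2 - (a 4)\<^sup>2) / a 3
      = u * ((Y + (a 2)\<^sup>2 - X) / a 2 + (Y + (a 3)\<^sup>2 - (a 4)\<^sup>2) / a 3)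
      + v * ((Y' + (a 2)\<^sup>2 - X') / a 2 + (Y' + (a 3)\<^sup>2 - (a 4)\<^sup>2) / a 3)"
      unfolding u(1) using assms by (simp add: divide_simps) (simp add: algebra_simps)
    then show ?thesis using lin [OF uv] z by simp
  qed
  ultimately show "u *\<^sub>R z + v *\<^sub>R z' \<in> pre_region a"
    by (simp add: eq pre_region_def)
qed

text \<open>The essential case is that of incomparable points. The condition at vertex 2 increases
  with X and decreases with Y, the one at vertex 3 the other way round. Each is therefore inherited
  from the point that shares its decreasing variable with the maximum.\<close>

lemma pre_region_join:
  assumes a: "a 1 > 0" "a 2 > 0" "a 3 > 0"
    and z: "(X, Y) \<in> pre_region a" "(X', Y') \<in> pre_region a"
  shows "(max X X', max Y Y') \<in> pre_region a"
proof -
  have join: "(X', Y) \<in> pre_region a"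
    if le: "X \<le> X'" "Y' \<le> Y" and z: "(X, Y) \<in> pre_region a" "(X', Y') \<in> pre_region a" for X Y X' Y'
  proof -
    note z = z [unfolded pre_region_def mem_Collect_eq prod.case]
    have pos: "X > 0" "Y > 0" "X' > 0" "Y' > 0" and h: "heron X Y ((a 2)\<^sup>2) > 0" "heron X' Y' ((a 2)\<^sup>2) > 0"
      and h': "heron X' ((a 0)\<^sup>2) ((a 1)\<^sup>2) > 0" "heron Y ((a 4)\<^sup>2) ((a 3)\<^sup>2) > 0"
      and at2: "0 < (X + (a 1)\<^sup>2 - (a 0)\<^sup>2) / a 1 + (X + (a 2)\<^sup>2 - Y) / a 2"
      and at3: "0 < (Y' + (a 2)\<^sup>2 - X') / a 2 + (Y' + (a 3)\<^sup>2 - (a 4)\<^sup>2) / a 3"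
      using z by blast+
    have "heron X' Y ((a 2)\<^sup>2) > 0"
      using a(2) by (intro heron_join [OF pos _ le h]) simp
    moreover have "0 < (X' + (a 1)\<^sup>2 - (a 0)\<^sup>2) / a 1 + (X' + (a 2)\<^sup>2 - Y) / a 2"
    proof -
      note at2
      also have "(X + (a 1)\<^sup>2 - (a 0)\<^sup>2) / a 1 + (X + (a 2)\<^sup>2 - Y) / a 2
        \<le> (X' + (a 1)\<^sup>2 - (a 0)\<^sup>2) / a 1 + (X' + (a 2)\<^sup>2 - Y) / a 2"
        using le a by (intro add_mono divide_right_mono) simp_all
      finally show ?thesis .
    qed
    moreover have "0 < (Y + (a 2)\<^sup>2 - X') / a 2 + (Y + (a 3)\<^sup>2 - (a 4)\<^sup>2) / a 3"
    proof -
      note at3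
      also have "(Y' + (a 2)\<^sup>2 - X') / a 2 + (Y' + (a 3)\<^sup>2 - (a 4)\<^sup>2) / a 3
        \<le> (Y + (a 2)\<^sup>2 - X') / a 2 + (Y + (a 3)\<^sup>2 - (a 4)\<^sup>2) / a 3"
        using le a by (intro add_mono divide_right_mono) simp_all
      finally show ?thesis .
    qed
    ultimately show ?thesis
      unfolding pre_region_def mem_Collect_eq prod.case using pos h' by blast
  qed
  consider "X \<le> X'" "Y \<le> Y'" | "X \<le> X'" "Y' \<le> Y" | "X' \<le> X" "Y \<le> Y'" | "X' \<le> X" "Y' \<le> Y"
    by linarith
  then show ?thesis
    using z join [of X X' Y' Y] join [of X' X Y Y'] by cases (simp_all only: max_absorb1 max_absorb2)
qed

text \<open>With m = 2 sqrt X, N / (m k) and sqrt h / (m k) are the cosine and sine of an angle. A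
  positive sum of cosines gives sin (r + s) > 0, and cot r + cot s = sin (r + s) / (sin r sin
  s).\<close>

lemma sum_cot_pos:
  assumes "X > 0" "k1 > 0" "k2 > 0" "h1 > 0" "h2 > 0"
    and "h1 = 4 * X * k1\<^sup>2 - N1\<^sup>2" "h2 = 4 * X * k2\<^sup>2 - N2\<^sup>2"
    and "N1 / k1 + N2 / k2 > 0"
  shows "N1 / sqrt h1 + N2 / sqrt h2 > 0"
proof -
  define m where "m = 2 * sqrt X"
  have m: "m > 0" "m\<^sup>2 = 4 * X" using assms by (simp_all add: m_def power_mult_distrib)
  define c1 s1 c2 s2 where "c1 = N1 / (m * k1)" "s1 = sqrt h1 / (m * k1)" "c2 = N2 / (m * k2)" "s2 = sqrt h2 / (m * k2)"
  note defs = this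
  have pos: "s1 > 0" "s2 > 0"
    using assms(2-5) m by (simp_all add: defs)
  have unit: "(N / (m * k))\<^sup>2 + (sqrt h / (m * k))\<^sup>2 = 1" if "k > 0" "h > 0" "h = 4 * X * k\<^sup>2 - N\<^sup>2" for N k h
  proof -
    have "(N / (m * k))\<^sup>2 + (sqrt h / (m * k))\<^sup>2 = (N\<^sup>2 + h) / (m * k)\<^sup>2"
      using that(2) by (simp add: power_divide add_divide_distrib)
    also have "N\<^sup>2 + h = (m * k)\<^sup>2"
      using that(3) m by (simp add: power_mult_distrib)
    finally show ?thesis using that(1) m(1) by simp
  qed
  have "c1\<^sup>2 + s1\<^sup>2 = 1" "c2\<^sup>2 + s2\<^sup>2 = 1"
    unfolding defs using assms by (intro unit; simp)+
  moreover have "c1 + c2 = (N1 / k1 + N2 / k2) / m"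
    using assms(2,3) m by (simp add: defs divide_simps)
  moreover have "(N1 / k1 + N2 / k2) / m > 0"
    using assms(8) m(1) by (rule divide_pos_pos)
  ultimately have "s1 * c2 + c1 * s2 > 0"
    using sum_cos_pos_iff [OF pos, of c1 c2] by simp
  then have "(s1 * c2 + c1 * s2) / (s1 * s2) > 0"
    using pos by simp
  also have "(s1 * c2 + c1 * s2) / (s1 * s2) = c1 / s1 + c2 / s2"
    using pos by (simp add: divide_simps)
  also have "\<dots> = N1 / sqrt h1 + N2 / sqrt h2"
    using assms(2,3) m(1) by (simp add: defs)
  finally show ?thesis .
qed

text \<open>Lengthening a diagonal from 0 opens the angles at its two sides, and closes the angle at 0:
  the derivative is minus a sum of cotangents, whose sign is that of convexity at 2 or 3.\<close>

lemma angle_sum_antimono: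
  assumes a: "\<forall>i<5. a i > 0"
    and z: "(X, Y) \<in> pre_region a" "(X', Y') \<in> pre_region a" "X \<le> X'" "Y \<le> Y'"
  shows "angle_sum a (X', Y') \<le> angle_sum a (X, Y)"
proof -
  have a': "a 0 > 0" "a 1 > 0" "a 2 > 0" "a 3 > 0" "a 4 > 0"
    using a by simp_all
  define x where "x u = (1 - u) * X + u * X'" for u
  define y where "y u = (1 - u) * Y + u * Y'" for u
  have xd: "(x has_real_derivative X' - X) (at u)" and yd: "(y has_real_derivative Y' - Y) (at u)" for u
    unfolding x_def y_def by (auto intro!: derivative_eq_intros)
  have mem: "(x u, y u) \<in> pre_region a" if "0 \<le> u" "u \<le> 1" for u
    using convexD_alt [OF convex_pre_region [OF a'(2-4)] z(1,2) that] by (simp add: x_def y_def)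
  have "angle_sum a (x 1, y 1) \<le> angle_sum a (x 0, y 0)"
  proof (rule DERIV_nonpos_imp_nonincreasing [where f = "\<lambda>u. angle_sum a (x u, y u)"])
    fix u :: real assume "0 \<le> u" "u \<le> 1"
    note m = mem [OF this, unfolded pre_region_def mem_Collect_eq prod.case]
    define h1 h2 h3 where "h1 = heron ((a 1)\<^sup>2) ((a 0)\<^sup>2) (x u)" "h2 = heron ((a 2)\<^sup>2) (x u) (y u)"
      "h3 = heron ((a 3)\<^sup>2) (y u) ((a 4)\<^sup>2)"
    note h_def = this
    define N1 N2 M2 M3 where "N1 = x u + (a 1)\<^sup>2 - (a 0)\<^sup>2" "N2 = x u + (a 2)\<^sup>2 - y u"
      "M2 = y u + (a 2)\<^sup>2 - x u" "M3 = y u + (a 3)\<^sup>2 - (a 4)\<^sup>2"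
    note N_def = this
    have pos: "x u > 0" "y u > 0"
      and at2: "N1 / a 1 + N2 / a 2 > 0" and at3: "M2 / a 2 + M3 / a 3 > 0"
      using m unfolding N_def by blast+
    have h: "h1 > 0" "h2 > 0" "h3 > 0"
      unfolding h_def heron_permute(1) [of "(a 1)\<^sup>2"] heron_permute(2) [of "(a 2)\<^sup>2"] heron_permute(2) [of "(a 3)\<^sup>2"]
        heron_permute(2) [of "y u" "(a 2)\<^sup>2"] heron_permute(2) [of "(a 4)\<^sup>2" "(a 3)\<^sup>2"]
      using m by blast+
    have h_eq: "h1 = 4 * x u * (a 1)\<^sup>2 - N1\<^sup>2" "h2 = 4 * x u * (a 2)\<^sup>2 - N2\<^sup>2"
      "h2 = 4 * y u * (a 2)\<^sup>2 - M2\<^sup>2" "h3 = 4 * y u * (a 3)\<^sup>2 - M3\<^sup>2"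
      unfolding h_def N_def heron_def by algebra+
    \<comment> \<open>As \<open>x\<close> is the square of the diagonal, this is the logarithmic
      derivative of the diagonal itself. It multiplies the two cotangents at vertex 2, and
      \<open>cY\<close> those at vertex 3.\<close>
    define cX where "cX = (X' - X) / (2 * x u)"
    define cY where "cY = (Y' - Y) / (2 * y u)"
    have c: "cX \<ge> 0" "cY \<ge> 0"
      using z(3,4) pos by (simp_all add: cX_def cY_def)
    have le: "cX * (N1 / sqrt h1 + N2 / sqrt h2) \<ge> 0" "cY * (M2 / sqrt h2 + M3 / sqrt h3) \<ge> 0"
      using c sum_cot_pos [OF pos(1) a'(2,3) h(1,2) h_eq(1,2) at2] sum_cot_pos [OF pos(2) a'(3,4) h(2,3) h_eq(3,4) at3]
      by (intro mult_nonneg_nonneg; simp)+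
    have sq: "(a 0)\<^sup>2 > 0" "(a 4)\<^sup>2 > 0"
      using a' by simp_all
    have "((\<lambda>u. angle ((a 1)\<^sup>2) ((a 0)\<^sup>2) (x u)) has_real_derivative - (N1 / x u * (X' - X)) / (2 * sqrt h1)) (at u)"
      using has_real_derivative_angle [OF DERIV_const xd sq(1) pos(1) h(1) [unfolded h_def]]
      by (simp add: h_def N_def)
    also have "- (N1 / x u * (X' - X)) / (2 * sqrt h1) = - (cX * (N1 / sqrt h1))"
      by (simp add: cX_def mult_ac)
    finally have 1: "((\<lambda>u. angle ((a 1)\<^sup>2) ((a 0)\<^sup>2) (x u)) has_real_derivative - (cX * (N1 / sqrt h1))) (at u)" .
    have "((\<lambda>u. angle ((a 2)\<^sup>2) (x u) (y u)) has_real_derivative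
        - (N2 / x u * (X' - X) + M2 / y u * (Y' - Y)) / (2 * sqrt h2)) (at u)"
      using has_real_derivative_angle [OF xd yd pos h(2) [unfolded h_def]] by (simp add: h_def N_def)
    also have "- (N2 / x u * (X' - X) + M2 / y u * (Y' - Y)) / (2 * sqrt h2) = - (cX * (N2 / sqrt h2)) - cY * (M2 / sqrt h2)"
    proof -
      have "- (p / r * A + q / t * B) / (2 * s) = - (A / (2 * r) * (p / s)) - B / (2 * t) * (q / s)"
        for p q r t s A B :: real
        by (simp add: add_divide_distrib diff_divide_distrib mult_ac)
      then show ?thesis
        unfolding cX_def cY_def by blast
    qed
    finally have 2: "((\<lambda>u. angle ((a 2)\<^sup>2) (x u) (y u)) has_real_derivative
      - (cX * (N2 / sqrt h2)) - cY * (M2 / sqrt h2)) (at u)" .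
    have "((\<lambda>u. angle ((a 3)\<^sup>2) (y u) ((a 4)\<^sup>2)) has_real_derivative - (M3 / y u * (Y' - Y)) / (2 * sqrt h3)) (at u)"
      using has_real_derivative_angle [OF yd DERIV_const pos(2) sq(2) h(3) [unfolded h_def]]
      by (simp add: h_def N_def)
    also have "- (M3 / y u * (Y' - Y)) / (2 * sqrt h3) = - (cY * (M3 / sqrt h3))"
      by (simp add: cY_def mult_ac)
    finally have 3: "((\<lambda>u. angle ((a 3)\<^sup>2) (y u) ((a 4)\<^sup>2)) has_real_derivative - (cY * (M3 / sqrt h3))) (at u)" .
    have "((\<lambda>u. angle_sum a (x u, y u)) has_real_derivative
       - (cX * (N1 / sqrt h1)) + (- (cX * (N2 / sqrt h2)) - cY * (M2 / sqrt h2)) + - (cY * (M3 / sqrt h3))) (at u)"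
      unfolding angle_sum_def fst_conv snd_conv by (intro DERIV_add 1 2 3)
    moreover have "- (cX * (N1 / sqrt h1)) + (- (cX * (N2 / sqrt h2)) - cY * (M2 / sqrt h2)) + - (cY * (M3 / sqrt h3)) \<le> 0"
      using le unfolding distrib_left by linarith
    ultimately show "\<exists>d. ((\<lambda>u. angle_sum a (x u, y u)) has_real_derivative d) (at u) \<and> d \<le> 0"
      by blast
  qed simp
  then show ?thesis by (simp add: x_def y_def)
qed

lemma path_connected_region:
  assumes a: "\<forall>i<5. a i > 0"
  shows "path_connected (region a)"
proof -
  have a': "a 1 > 0" "a 2 > 0" "a 3 > 0" using a by simp_all
  \<comment> \<open>The angle condition propagates from the start of a monotone segment to all of
    it. So the maximum, known beforehand only to lie in \<open>pre_region\<close>, is reached inside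
    \<open>region\<close>.\<close>
  have up: "path_component (region a) (X, Y) (X', Y')"
    if z: "(X, Y) \<in> region a" "(X', Y') \<in> pre_region a" "X \<le> X'" "Y \<le> Y'" for X Y X' Y'
  proof (rule path_component_of_subset)
    show "closed_segment (X, Y) (X', Y') \<subseteq> region a"
    proof
      fix w assume "w \<in> closed_segment (X, Y) (X', Y')"
      then obtain u where u: "0 \<le> u" "u \<le> 1" and w: "w = ((1 - u) * X + u * X', (1 - u) * Y + u * Y')"
        by (auto simp: closed_segment_def)
      have z0: "(X, Y) \<in> pre_region a" using z by (simp add: region_def)
      then have wp: "w \<in> pre_region a"
        using convexD_alt [OF convex_pre_region [OF a'] z0 z(2) u] by (simp add: w)
      have le: "p \<le> (1 - u) * p + u * q" if "p \<le> q" for p q :: real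
        using mult_left_mono [OF that u(1)] by (simp add: algebra_simps)
      have "angle_sum a w \<le> angle_sum a (X, Y)"
        using wp unfolding w by (intro angle_sum_antimono [OF a z0] le z(3,4))
      then show "w \<in> region a"
        using wp z by (simp add: region_def)
    qed
    show "path_component (closed_segment (X, Y) (X', Y')) (X, Y) (X', Y')"
      using path_connected_segment [of "(X, Y)" "(X', Y')"] by (auto simp: path_connected_component)
  qed
  show ?thesis
    unfolding path_connected_component
  proof safe
    fix X Y X' Y' assume z: "(X, Y) \<in> region a" "(X', Y') \<in> region a"
    let ?J = "(max X X', max Y Y')"
    have "?J \<in> pre_region a"
      using z by (intro pre_region_join a') (simp_all add: region_def)
    then have "path_component (region a) (X, Y) ?J" "path_component (region a) (X', Y') ?J"
      by (intro up z; simp)+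
    then show "path_component (region a) (X, Y) (X', Y')"
      using path_component_sym path_component_trans by blast
  qed
qed

section \<open>Convex pentagons from the diagonals at a vertex\<close>

text \<open>The constant function 0 already places vertex 0 at the origin. Writing vertex 1 with
  \<open>cis 0\<close> puts it in the polar form to which \<open>cross2_polar\<close> and
  \<open>dist_polar\<close> apply.\<close>

definition pent :: "(nat \<Rightarrow> real) \<Rightarrow> real \<times> real \<Rightarrow> pentagon" where
  "pent a z =
    (let \<alpha> = angle ((a 1)\<^sup>2) ((a 0)\<^sup>2) (fst z);
         \<beta> = angle ((a 2)\<^sup>2) (fst z) (snd z);
         \<gamma> = angle ((a 3)\<^sup>2) (snd z) ((a 4)\<^sup>2)
     in (\<lambda>_. 0)(1 := complex_of_real (a 0) * cis 0, 2 := complex_of_real (sqrt (fst z)) * cis \<alpha>,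
          3 := complex_of_real (sqrt (snd z)) * cis (\<alpha> + \<beta>), 4 := complex_of_real (a 4) * cis (\<alpha> + \<beta> + \<gamma>)))"

lemma cross2_polar:
  "cross2 (complex_of_real r * cis \<phi>) (complex_of_real s * cis \<psi>) = r * s * sin (\<psi> - \<phi>)"
  by (simp add: cross2_expand sin_diff algebra_simps)

lemma dist_polar:
  "(dist (complex_of_real r * cis \<phi>) (complex_of_real s * cis \<psi>))\<^sup>2 = r\<^sup>2 + s\<^sup>2 - 2 * r * s * cos (\<psi> - \<phi>)"
proof -
  have "(dist (complex_of_real r * cis \<phi>) (complex_of_real s * cis \<psi>))\<^sup>2
      = (r * cos \<phi> - s * cos \<psi>)\<^sup>2 + (r * sin \<phi> - s * sin \<psi>)\<^sup>2"
    by (simp add: dist_norm cmod_power2)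
  also have "\<dots> = r\<^sup>2 + s\<^sup>2 - 2 * r * s * cos (\<psi> - \<phi>)"
    unfolding cos_diff using sin_cos_squared_add [of \<phi>] sin_cos_squared_add [of \<psi>] by algebra
  finally show ?thesis .
qed

text \<open>This is the angle criterion at vertex i with the ray to k in the middle, written in
  distances only. Applied at vertices 2 and 3 with the diagonal to 0 as middle ray, it gives the
  linear conditions of \<open>pre_region\<close>.\<close>

lemma orient_trans_pos_iff:
  assumes "orient P i j k > 0" "orient P i k l > 0"
  shows "orient P i j l > 0 \<longleftrightarrow>
    ((dist (P i) (P j))\<^sup>2 + (dist (P i) (P k))\<^sup>2 - (dist (P j) (P k))\<^sup>2) / dist (P i) (P j) +
    ((dist (P i) (P k))\<^sup>2 + (dist (P i) (P l))\<^sup>2 - (dist (P k) (P l))\<^sup>2) / dist (P i) (P l) > 0"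
proof -
  have n: "norm (P m - P i) = dist (P i) (P m)" for m
    by (metis dist_norm dist_commute)
  have d: "dist (P m - P i) (P m' - P i) = dist (P m) (P m')" for m m'
    by (simp add: dist_norm)
  have half: "p / 2 / r + q / 2 / t = (p / r + q / t) / 2" for p q r t :: real
    by (simp add: add_divide_distrib)
  show ?thesis
    using cross2_trans_pos_iff [OF assms [unfolded orient_def]]
    unfolding orient_def inner_eq_dist n d half by simp
qed

lemma heron_orient:
  "heron ((dist (P j) (P k))\<^sup>2) ((dist (P i) (P j))\<^sup>2) ((dist (P i) (P k))\<^sup>2) = 4 * (orient P i j k)\<^sup>2"
  by (simp add: heron_def orient_expand dist_norm cmod_power2) algebra

text \<open>The two missing triples come from three-term Grassmann-Pluecker relations with common
  vertex 2 and common vertex 3.\<close>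

lemma pos_convexI:
  assumes "orient P 0 1 2 > 0" "orient P 0 1 3 > 0" "orient P 0 1 4 > 0" "orient P 0 2 3 > 0"
    "orient P 0 2 4 > 0" "orient P 0 3 4 > 0" "orient P 1 2 3 > 0" "orient P 2 3 4 > 0"
  shows "pos_convex P"
proof -
  have "orient P 0 2 3 * orient P 1 2 4 = orient P 0 1 2 * orient P 2 3 4 + orient P 0 2 4 * orient P 1 2 3"
    "orient P 0 2 3 * orient P 1 3 4 = orient P 0 1 3 * orient P 2 3 4 + orient P 0 3 4 * orient P 1 2 3"
    unfolding orient_expand by algebra+
  moreover have "orient P 0 1 2 * orient P 2 3 4 + orient P 0 2 4 * orient P 1 2 3 > 0"
    "orient P 0 1 3 * orient P 2 3 4 + orient P 0 3 4 * orient P 1 2 3 > 0"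
    by (intro add_pos_pos mult_pos_pos assms)+
  ultimately have "orient P 1 2 4 > 0" "orient P 1 3 4 > 0"
    using assms(4) by (metis zero_less_mult_pos)+
  then show ?thesis
    using assms by (simp add: pos_convex_iff)
qed

lemma pent_convex:
  assumes a: "\<forall>i<5. a i > 0" and z: "(X, Y) \<in> region a"
  shows "pent a (X, Y) \<in> linkage_configs a" "pos_convex (pent a (X, Y))"
proof -
  have a': "a 0 > 0" "a 1 > 0" "a 2 > 0" "a 3 > 0" "a 4 > 0"
    using a by simp_all
  define P where "P = pent a (X, Y)"
  define \<alpha> where "\<alpha> = angle ((a 1)\<^sup>2) ((a 0)\<^sup>2) X"
  define \<beta> where "\<beta> = angle ((a 2)\<^sup>2) X Y"
  define \<gamma> where "\<gamma> = angle ((a 3)\<^sup>2) Y ((a 4)\<^sup>2)"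
  have P: "P 0 = 0" "P 1 = complex_of_real (a 0) * cis 0" "P 2 = complex_of_real (sqrt X) * cis \<alpha>"
    "P 3 = complex_of_real (sqrt Y) * cis (\<alpha> + \<beta>)" "P 4 = complex_of_real (a 4) * cis (\<alpha> + \<beta> + \<gamma>)"
    by (simp_all add: P_def pent_def Let_def \<alpha>_def \<beta>_def \<gamma>_def)
  have "(X, Y) \<in> pre_region a" and sum: "\<alpha> + \<beta> + \<gamma> < pi"
    using z by (simp_all add: region_def angle_sum_def \<alpha>_def \<beta>_def \<gamma>_def)
  note m = this(1) [unfolded pre_region_def mem_Collect_eq prod.case]
  have pos: "X > 0" "Y > 0"
    and at2: "(X + (a 1)\<^sup>2 - (a 0)\<^sup>2) / a 1 + (X + (a 2)\<^sup>2 - Y) / a 2 > 0"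
    and at3: "(Y + (a 2)\<^sup>2 - X) / a 2 + (Y + (a 3)\<^sup>2 - (a 4)\<^sup>2) / a 3 > 0"
    using m by blast+
  have h: "heron ((a 1)\<^sup>2) ((a 0)\<^sup>2) X > 0" "heron ((a 2)\<^sup>2) X Y > 0" "heron ((a 3)\<^sup>2) Y ((a 4)\<^sup>2) > 0"
    unfolding heron_permute(1) [of "(a 1)\<^sup>2"] heron_permute(2) [of "(a 2)\<^sup>2"] heron_permute(2) [of "(a 3)\<^sup>2"]
      heron_permute(2) [of Y "(a 2)\<^sup>2"] heron_permute(2) [of "(a 4)\<^sup>2" "(a 3)\<^sup>2"]
    using m by blast+
  have sq: "(a 0)\<^sup>2 > 0" "(a 4)\<^sup>2 > 0"
    using a' by simp_all
  have ang: "0 < \<alpha>" "0 < \<beta>" "0 < \<gamma>"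
    using angle_bounds(1) [OF sq(1) pos(1) h(1)] angle_bounds(1) [OF pos h(2)] angle_bounds(1) [OF pos(2) sq(2) h(3)]
    by (simp_all add: \<alpha>_def \<beta>_def \<gamma>_def)
  have sqrt: "sqrt X > 0" "sqrt Y > 0" "(sqrt X)\<^sup>2 = X" "(sqrt Y)\<^sup>2 = Y"
    using pos by simp_all
  have d: "dist (P 0) (P 1) = a 0" "dist (P 0) (P 2) = sqrt X" "dist (P 0) (P 3) = sqrt Y" "dist (P 0) (P 4) = a 4"
    using sqrt a' by (simp_all add: P [simplified] norm_mult)
  have "(dist (P 1) (P 2))\<^sup>2 = (a 1)\<^sup>2"
    unfolding P dist_polar using law_of_cosines [OF sq(1) pos(1) h(1)] sqrt a' by (simp add: \<alpha>_def)
  then have d12: "dist (P 1) (P 2) = a 1"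
    using a' by (simp add: power2_eq_iff_nonneg)
  have "(dist (P 2) (P 3))\<^sup>2 = (a 2)\<^sup>2"
    unfolding P dist_polar using law_of_cosines [OF pos h(2)] sqrt a' by (simp add: \<beta>_def)
  then have d23: "dist (P 2) (P 3) = a 2"
    using a' by (simp add: power2_eq_iff_nonneg)
  have "(dist (P 3) (P 4))\<^sup>2 = (a 3)\<^sup>2"
    unfolding P dist_polar using law_of_cosines [OF pos(2) sq(2) h(3)] sqrt a' by (simp add: \<gamma>_def)
  then have d34: "dist (P 3) (P 4) = a 3"
    using a' by (simp add: power2_eq_iff_nonneg)
  show "pent a (X, Y) \<in> linkage_configs a"
    unfolding P_def [symmetric] linkage_configs_iff using d d12 d23 d34 by simp
  have o0: "orient P 0 j k = cross2 (P j) (P k)" for j k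
    by (simp add: orient_def P)
  have o012: "orient P 0 1 2 > 0" and o013: "orient P 0 1 3 > 0" and o014: "orient P 0 1 4 > 0"
    and o023: "orient P 0 2 3 > 0" and o024: "orient P 0 2 4 > 0" and o034: "orient P 0 3 4 > 0"
    unfolding o0 P cross2_polar
    by (intro mult_pos_pos sin_gt_zero a' sqrt; use ang sum in linarith)+
  have ds: "dist (P 2) (P 0) = sqrt X" "dist (P 3) (P 0) = sqrt Y" "dist (P 2) (P 1) = a 1"
      "dist (P 3) (P 2) = a 2" "dist (P 4) (P 0) = a 4"
    using d d12 d23 by (simp_all add: dist_commute)
  \<comment> \<open>The triples are rotated so that the vertex of the angle comes first and vertex 0
    marks the middle ray.\<close>
  have "orient P 2 3 0 > 0" "orient P 2 0 1 > 0" "orient P 3 4 0 > 0" "orient P 3 0 2 > 0"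
    using o012 o023 o034 orient_rotate by metis+
  note trans = orient_trans_pos_iff [OF this(1,2), unfolded ds d d23 sqrt]
    orient_trans_pos_iff [OF this(3,4), unfolded ds d d34 sqrt]
  have "orient P 2 3 1 > 0"
    unfolding trans using at2 by (simp add: add_ac)
  moreover have "orient P 3 4 2 > 0"
    unfolding trans using at3 by (simp add: add_ac)
  ultimately show "pos_convex (pent a (X, Y))"
    unfolding P_def [symmetric]
    by (intro pos_convexI o012 o013 o014 o023 o024 o034) (simp_all only: orient_rotate [of P 2 3 1] orient_rotate [of P 3 4 2])
qed

text \<open>A positive cross product puts the argument of w / v strictly between 0 and pi, where the
  cosine, and hence the triangle's side lengths, determine it.\<close>

lemma polar_step:
  assumes "cross2 v w > 0"
  shows "w = v / norm v * norm w * cis (angle ((dist v w)\<^sup>2) ((norm v)\<^sup>2) ((norm w)\<^sup>2))"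
proof -
  have nz: "v \<noteq> 0" "w \<noteq> 0"
    using assms by (auto simp: cross2_def)
  define \<phi> where "\<phi> = Arg (w / v)"
  have "Im (w / v) = cross2 v w / (norm v)\<^sup>2"
    by (simp add: Im_divide cross2_expand cmod_power2 algebra_simps)
  then have "0 < Im (w / v)"
    using assms nz by simp
  then have \<phi>: "0 < \<phi>" "\<phi> < pi"
    unfolding \<phi>_def using Arg_lt_pi by blast+
  have "w / v = of_real (norm w / norm v) * cis \<phi>"
    using rcis_cmod_Arg [of "w / v"] by (simp add: rcis_def \<phi>_def norm_divide)
  then have w: "w = v / norm v * norm w * cis \<phi>"
    using nz by (simp add: field_simps)
  have "v \<bullet> w = norm v * norm w * cos \<phi>"
  proof -
    have "v \<bullet> (of_real r * (v * cis \<phi>)) = r * (norm v)\<^sup>2 * cos \<phi>" for r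
      by (simp add: inner_complex_def cmod_power2) (simp add: power2_eq_square algebra_simps)
    moreover have "w = of_real (norm w / norm v) * (v * cis \<phi>)"
      by (subst w) simp
    ultimately have "v \<bullet> w = norm w / norm v * (norm v)\<^sup>2 * cos \<phi>"
      by metis
    then show ?thesis using nz by (simp add: power2_eq_square)
  qed
  then have "(dist v w)\<^sup>2 = (norm v)\<^sup>2 + (norm w)\<^sup>2 - 2 * sqrt ((norm v)\<^sup>2) * sqrt ((norm w)\<^sup>2) * cos \<phi>"
    by (simp add: inner_eq_dist)
  then have "angle ((dist v w)\<^sup>2) ((norm v)\<^sup>2) ((norm w)\<^sup>2) = \<phi>"
    using nz \<phi> by (intro angle_unique) simp_all
  then show ?thesis using w by simp
qed

lemma pos_convex_region:
  assumes a: "\<forall>i<5. a i > 0" and P: "P \<in> linkage_configs a" "pos_convex P"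
  defines "z \<equiv> ((dist (P 0) (P 2))\<^sup>2, (dist (P 0) (P 3))\<^sup>2)"
  shows "z \<in> region a" "congruent_pent (pent a z) P"
proof -
  have a': "a 0 > 0" "a 1 > 0" "a 2 > 0" "a 3 > 0" "a 4 > 0"
    using a by simp_all
  have o: "orient P 0 1 2 > 0" "orient P 0 1 3 > 0" "orient P 0 1 4 > 0" "orient P 0 2 3 > 0"
    "orient P 0 2 4 > 0" "orient P 0 3 4 > 0" "orient P 1 2 3 > 0" "orient P 2 3 4 > 0"
    using P(2) unfolding pos_convex_iff by blast+
  define x where "x = dist (P 0) (P 2)"
  define y where "y = dist (P 0) (P 3)"
  define X where "X = x\<^sup>2"
  define Y where "Y = y\<^sup>2"
  have z: "z = (X, Y)"
    by (simp add: z_def X_def Y_def x_def y_def)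
  have d: "dist (P 0) (P 1) = a 0" "dist (P 1) (P 2) = a 1" "dist (P 2) (P 3) = a 2" "dist (P 3) (P 4) = a 3"
    "dist (P 0) (P 4) = a 4" "dist (P 0) (P 2) = x" "dist (P 0) (P 3) = y"
    using P(1) by (simp_all add: linkage_configs_iff x_def y_def)
  have ds: "dist (P 2) (P 0) = x" "dist (P 3) (P 0) = y" "dist (P 2) (P 1) = a 1" "dist (P 3) (P 2) = a 2"
    "dist (P 4) (P 0) = a 4" "dist (P 1) (P 0) = a 0"
    using d by (simp_all add: dist_commute)
  have "P 0 \<noteq> P 2" "P 0 \<noteq> P 3"
    using pos_convex_finite_energy [OF P(2)] by (simp_all add: finite_energy_def)
  then have xy: "x > 0" "y > 0"
    by (simp_all add: x_def y_def)
  then have XY: "X > 0" "Y > 0"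
    by (simp_all add: X_def Y_def)
  have sq: "(a 0)\<^sup>2 > 0" "(a 4)\<^sup>2 > 0"
    using a' by simp_all
  have o2: "4 * (orient P i j k)\<^sup>2 > 0" if "orient P i j k > 0" for i j k
    using that by simp
  have h: "heron ((a 1)\<^sup>2) ((a 0)\<^sup>2) X > 0" "heron ((a 2)\<^sup>2) X Y > 0" "heron ((a 3)\<^sup>2) Y ((a 4)\<^sup>2) > 0"
    unfolding X_def Y_def
    using heron_orient [of P 1 2 0] heron_orient [of P 2 3 0] heron_orient [of P 3 4 0] o2 o unfolding d by auto
  then have h': "heron X ((a 0)\<^sup>2) ((a 1)\<^sup>2) > 0" "heron X Y ((a 2)\<^sup>2) > 0" "heron Y ((a 4)\<^sup>2) ((a 3)\<^sup>2) > 0"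
    unfolding heron_permute(1) [of X "(a 0)\<^sup>2"] heron_permute(2) [of X Y] heron_permute(2) [of Y "(a 4)\<^sup>2"] .
  have r: "orient P 2 3 0 > 0" "orient P 2 0 1 > 0" "orient P 3 4 0 > 0" "orient P 3 0 2 > 0"
    "orient P 2 3 1 > 0" "orient P 3 4 2 > 0"
    using o orient_rotate by metis+
  have "((a 2)\<^sup>2 + X - Y) / a 2 + (X + (a 1)\<^sup>2 - (a 0)\<^sup>2) / a 1 > 0"
    unfolding X_def Y_def using orient_trans_pos_iff [OF r(1,2), unfolded ds d] r(5) by blast
  moreover have "((a 3)\<^sup>2 + Y - (a 4)\<^sup>2) / a 3 + (Y + (a 2)\<^sup>2 - X) / a 2 > 0"
    unfolding X_def Y_def using orient_trans_pos_iff [OF r(3,4), unfolded ds d] r(6) by blast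
  ultimately have pre: "(X, Y) \<in> pre_region a"
    unfolding pre_region_def mem_Collect_eq prod.case using XY h' by (simp add: add_ac)
  define \<alpha> where "\<alpha> = angle ((a 1)\<^sup>2) ((a 0)\<^sup>2) X"
  define \<beta> where "\<beta> = angle ((a 2)\<^sup>2) X Y"
  define \<gamma> where "\<gamma> = angle ((a 3)\<^sup>2) Y ((a 4)\<^sup>2)"
  have ang: "0 < \<alpha>" "0 < \<beta>" "0 < \<gamma>" "\<alpha> < pi" "\<beta> < pi" "\<gamma> < pi"
    using angle_bounds [OF sq(1) XY(1) h(1)] angle_bounds [OF XY h(2)] angle_bounds [OF XY(2) sq(2) h(3)]
    by (simp_all add: \<alpha>_def \<beta>_def \<gamma>_def)
  define b where "b i = P i - P 0" for i
  have nb: "norm (b 1) = a 0" "norm (b 2) = x" "norm (b 3) = y" "norm (b 4) = a 4"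
    using ds by (simp_all add: b_def flip: dist_norm)
  have db: "dist (b i) (b j) = dist (P i) (P j)" for i j
    by (simp add: b_def dist_norm)
  have cb: "cross2 (b i) (b j) = orient P 0 i j" for i j
    by (simp add: b_def orient_def)
  define u where "u = b 1 / a 0"
  have u: "norm u = 1"
    using nb a' by (simp add: u_def norm_divide)
  have b1: "b 1 = u * (of_real (a 0) * cis 0)"
    using a' by (simp add: u_def)
  have "b 2 = b 1 / a 0 * x * cis \<alpha>"
    using polar_step [of "b 1" "b 2"] o(1) unfolding cb db nb d \<alpha>_def X_def by blast
  then have b2: "b 2 = u * (of_real x * cis \<alpha>)"
    by (simp add: u_def)
  have "b 3 = b 2 / x * y * cis \<beta>"
    using polar_step [of "b 2" "b 3"] o(4) unfolding cb db nb d \<beta>_def X_def Y_def by blast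
  then have b3: "b 3 = u * (of_real y * cis (\<alpha> + \<beta>))"
    using xy by (simp add: b2 cis_mult [symmetric])
  have "b 4 = b 3 / y * a 4 * cis \<gamma>"
    using polar_step [of "b 3" "b 4"] o(6) unfolding cb db nb d \<gamma>_def Y_def by blast
  then have b4: "b 4 = u * (of_real (a 4) * cis (\<alpha> + \<beta> + \<gamma>))"
    using xy by (simp add: b3 cis_mult [symmetric])
  have rot: "cross2 (u * p) (u * q) = cross2 p q" for p q
  proof -
    have "cross2 (u * p) (u * q) = (norm u)\<^sup>2 * cross2 p q"
      unfolding cmod_power2 by (simp add: cross2_expand power2_eq_square algebra_simps)
    then show ?thesis using u by simp
  qed
  \<comment> \<open>Adding the angles one at a time keeps each partial sum below 2 pi, where a
    positive sine rules out values of pi or more.\<close>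
  have lt_pi: "\<phi> < pi" if "sin \<phi> > 0" "\<phi> < 2 * pi" for \<phi>
    using sin_le_zero [of \<phi>] that by linarith
  have "a 0 * y * sin (\<alpha> + \<beta>) > 0"
    using o(2) unfolding cb [symmetric] b1 b3 rot cross2_polar by simp
  then have "sin (\<alpha> + \<beta>) > 0"
    by (rule zero_less_mult_pos) (use a' xy in simp)
  then have "\<alpha> + \<beta> < pi"
    using ang by (intro lt_pi) auto
  moreover have "a 0 * a 4 * sin (\<alpha> + \<beta> + \<gamma>) > 0"
    using o(3) unfolding cb [symmetric] b1 b4 rot cross2_polar by simp
  then have "sin (\<alpha> + \<beta> + \<gamma>) > 0"
    by (rule zero_less_mult_pos) (use a' in simp)
  ultimately have "\<alpha> + \<beta> + \<gamma> < pi"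
    using ang by (intro lt_pi) auto
  then show "z \<in> region a"
    using pre by (simp add: z region_def angle_sum_def \<alpha>_def \<beta>_def \<gamma>_def)
  have "sqrt X = x" "sqrt Y = y"
    using xy by (simp_all add: X_def Y_def)
  then have Q: "pent a z 0 = 0" "pent a z 1 = of_real (a 0) * cis 0" "pent a z 2 = of_real x * cis \<alpha>"
    "pent a z 3 = of_real y * cis (\<alpha> + \<beta>)" "pent a z 4 = of_real (a 4) * cis (\<alpha> + \<beta> + \<gamma>)"
    by (simp_all add: pent_def Let_def z \<alpha>_def \<beta>_def \<gamma>_def)
  define f where "f w = P 0 + u * w" for w
  have "f v - f w = u * (v - w)" for v w
    by (simp add: f_def algebra_simps)
  then have "dist (f v) (f w) = dist v w" for v w
    using u by (simp add: dist_norm norm_mult)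
  moreover have "\<forall>i<5. P i = f (pent a z i)"
    unfolding all_less_5_iff f_def Q b1 [symmetric] b2 [symmetric] b3 [symmetric] b4 [symmetric]
    by (simp add: b_def)
  ultimately show "congruent_pent (pent a z) P"
    unfolding congruent_pent_def by blast
qed

section \<open>Continuity of configurations and charges\<close>

lemma continuous_on_angle:
  assumes "continuous_on S B" "continuous_on S C"
    and pos: "\<And>x. x \<in> S \<Longrightarrow> B x > 0 \<and> C x > 0 \<and> heron A (B x) (C x) > 0"
  shows "continuous_on S (\<lambda>x. angle A (B x) (C x))"
  unfolding angle_def
proof (rule continuous_on_arccos)
  show "continuous_on S (\<lambda>x. cos_angle A (B x) (C x))"
    unfolding cos_angle_def
  proof (intro continuous_intros assms ballI)
    fix x assume "x \<in> S"
    then show "2 * sqrt (B x) * sqrt (C x) \<noteq> 0"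
      using pos [of x] by simp
  qed
  show "\<forall>x\<in>S. - 1 \<le> cos_angle A (B x) (C x) \<and> cos_angle A (B x) (C x) \<le> 1"
    using pos cos_angle_bounds less_imp_le by metis
qed

lemma continuous_on_pent:
  assumes a: "\<forall>i<5. a i > 0"
  shows "continuous_on (region a) (\<lambda>z. pent a z i)"
proof -
  have "a 0 > 0" "a 4 > 0"
    using a by simp_all
  then have sq: "(a 0)\<^sup>2 > 0" "(a 4)\<^sup>2 > 0"
    by simp_all
  have m: "fst z > 0 \<and> snd z > 0 \<and> heron ((a 1)\<^sup>2) ((a 0)\<^sup>2) (fst z) > 0 \<and>
     heron ((a 2)\<^sup>2) (fst z) (snd z) > 0 \<and> heron ((a 3)\<^sup>2) (snd z) ((a 4)\<^sup>2) > 0" if "z \<in> region a" for z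
  proof -
    have "(fst z, snd z) \<in> pre_region a"
      using that by (simp add: region_def)
    note z = this [unfolded pre_region_def mem_Collect_eq prod.case]
    show ?thesis
      unfolding heron_permute(1) [of "(a 1)\<^sup>2"] heron_permute(2) [of "(a 2)\<^sup>2"] heron_permute(2) [of "(a 3)\<^sup>2"]
        heron_permute(2) [of "snd z" "(a 2)\<^sup>2"] heron_permute(2) [of "(a 4)\<^sup>2" "(a 3)\<^sup>2"]
      using z by blast
  qed
  have fs: "continuous_on (region a) fst" "continuous_on (region a) snd"
    by (intro continuous_intros)+
  have "continuous_on (region a) (\<lambda>z. angle ((a 1)\<^sup>2) ((a 0)\<^sup>2) (fst z))"
    "continuous_on (region a) (\<lambda>z. angle ((a 2)\<^sup>2) (fst z) (snd z))"
    "continuous_on (region a) (\<lambda>z. angle ((a 3)\<^sup>2) (snd z) ((a 4)\<^sup>2))"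
    by (intro continuous_on_angle continuous_on_const fs; use m sq in blast)+
  note cont = this fs continuous_on_cis continuous_on_mult continuous_on_of_real continuous_on_real_sqrt continuous_on_add continuous_on_const
  consider "i = 1" | "i = 2" | "i = 3" | "i = 4" | "i \<notin> {1,2,3,4}"
    by blast
  then show ?thesis
  proof cases
    case 1
    then show ?thesis by (simp add: pent_def Let_def)
  next
    case 2
    then show ?thesis by (simp add: pent_def Let_def del: One_nat_def) (intro cont)
  next
    case 3
    then show ?thesis by (simp add: pent_def Let_def del: One_nat_def) (intro cont)
  next
    case 4
    then show ?thesis by (simp add: pent_def Let_def del: One_nat_def) (intro cont)
  next
    case 5
    then show ?thesis by (simp add: pent_def Let_def)
  qed
qed

text \<open>Reflections count as isometries, so a clockwise pentagon is represented by its conjugate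
  and one connected parameter region covers both orientations.\<close>

lemma convex_configs_pent:
  assumes a: "\<forall>i<5. a i > 0" and P: "P \<in> convex_configs a"
  obtains z where "z \<in> region a" "congruent_pent (pent a z) P"
proof -
  have P': "P \<in> linkage_configs a" and "pos_convex P \<or> pos_convex (\<lambda>i. cnj (P i))"
    using P by (simp_all add: convex_configs_def strictly_convex_pent_iff)
  then consider "pos_convex P" | "pos_convex (\<lambda>i. cnj (P i))"
    by blast
  then show thesis
  proof cases
    case 1
    then show ?thesis
      using pos_convex_region [OF a P'] that by blast
  next
    case 2
    have dist_cnj: "dist (cnj v) (cnj w) = dist v w" for v w
      by (simp add: dist_norm flip: complex_cnj_diff)
    then have "(\<lambda>i. cnj (P i)) \<in> linkage_configs a"
      using P' by (simp add: linkage_configs_def)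
    from pos_convex_region [OF a this 2] obtain z where z: "z \<in> region a" "congruent_pent (pent a z) (\<lambda>i. cnj (P i))"
      by blast
    then obtain f where "\<And>v w. dist (f v) (f w) = dist v w" "\<And>i. i < 5 \<Longrightarrow> cnj (P i) = f (pent a z i)"
      unfolding congruent_pent_def by blast
    then have "\<forall>v w. dist (cnj (f v)) (cnj (f w)) = dist v w" "\<forall>i<5. P i = cnj (f (pent a z i))"
      by (simp_all add: dist_cnj) (metis complex_cnj_cnj)
    then have "congruent_pent (pent a z) P"
      unfolding congruent_pent_def by (intro exI [of _ "\<lambda>w. cnj (f w)"] conjI)
    then show ?thesis using z that by blast
  qed
qed

text \<open>Equilibrium of the linkage amounts to the two equations \<open>t A + s t B = C\<close> and
  \<open>s A' + s t B' = C'\<close> with the following coefficients, one for each of the edges 23 and 34.\<close>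

definition coeffs :: "real \<Rightarrow> real \<Rightarrow> real \<Rightarrow> pentagon \<Rightarrow> nat \<Rightarrow> real" where
  "coeffs q1 q2 q4 P = (let
      A = q1 / dist (P 0) (P 2) ^ 3 * orient P 0 1 2 / orient P 1 2 3;
      B = orient P 1 2 4 / dist (P 2) (P 4) ^ 3 / orient P 1 2 3;
      C = (q1 * q4 / dist (P 0) (P 3) ^ 3 * orient P 0 3 4 + q2 * q4 / dist (P 1) (P 3) ^ 3 * orient P 1 3 4) / orient P 2 3 4;
      A' = q2 / dist (P 1) (P 4) ^ 3 * orient P 0 1 4 / orient P 0 3 4;
      B' = orient P 0 2 4 / dist (P 2) (P 4) ^ 3 / orient P 0 3 4;
      C' = (q1 * q4 / dist (P 0) (P 3) ^ 3 * orient P 0 2 3 + q2 * q4 / dist (P 1) (P 3) ^ 3 * orient P 1 2 3) / orient P 2 3 4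
    in (\<lambda>_. 0)(0 := A, 1 := B, 2 := C, 3 := A', 4 := B', 5 := C'))"

lemma coeffs_eq:
  "coeffs q1 q2 q4 P 0 = q1 / dist (P 0) (P 2) ^ 3 * orient P 0 1 2 / orient P 1 2 3"
  "coeffs q1 q2 q4 P 1 = orient P 1 2 4 / dist (P 2) (P 4) ^ 3 / orient P 1 2 3"
  "coeffs q1 q2 q4 P 2 = (q1 * q4 / dist (P 0) (P 3) ^ 3 * orient P 0 3 4 + q2 * q4 / dist (P 1) (P 3) ^ 3 * orient P 1 3 4) / orient P 2 3 4"
  "coeffs q1 q2 q4 P 3 = q2 / dist (P 1) (P 4) ^ 3 * orient P 0 1 4 / orient P 0 3 4"
  "coeffs q1 q2 q4 P 4 = orient P 0 2 4 / dist (P 2) (P 4) ^ 3 / orient P 0 3 4"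
  "coeffs q1 q2 q4 P 5 = (q1 * q4 / dist (P 0) (P 3) ^ 3 * orient P 0 2 3 + q2 * q4 / dist (P 1) (P 3) ^ 3 * orient P 1 2 3) / orient P 2 3 4"
  by (simp_all add: coeffs_def Let_def)

definition charge_s :: "real \<Rightarrow> real \<Rightarrow> real \<Rightarrow> pentagon \<Rightarrow> real" where
  "charge_s q1 q2 q4 P = (let k = coeffs q1 q2 q4 P in solve_s (k 0) (k 1) (k 2) (k 3) (k 4) (k 5))"

definition charge_t :: "real \<Rightarrow> real \<Rightarrow> real \<Rightarrow> pentagon \<Rightarrow> real" where
  "charge_t q1 q2 q4 P = (let k = coeffs q1 q2 q4 P in k 2 / (k 0 + charge_s q1 q2 q4 P * k 1))"

lemma pos_convex_dist_pos:
  assumes "pos_convex P"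
  shows "dist (P 0) (P 3) > 0" "dist (P 1) (P 3) > 0" "dist (P 0) (P 2) > 0" "dist (P 1) (P 4) > 0" "dist (P 2) (P 4) > 0"
  using pos_convex_finite_energy [OF assms] by (simp_all add: finite_energy_def)

lemma coeffs_pos:
  assumes "pos_convex P" "q1 > 0" "q2 > 0" "q4 > 0" "i < 6"
  shows "coeffs q1 q2 q4 P i > 0"
proof -
  have o: "orient P 0 1 2 > 0" "orient P 0 1 4 > 0" "orient P 0 2 3 > 0"
    "orient P 0 2 4 > 0" "orient P 0 3 4 > 0" "orient P 1 2 3 > 0" "orient P 1 2 4 > 0" "orient P 1 3 4 > 0" "orient P 2 3 4 > 0"
    using assms(1) unfolding pos_convex_iff by blast+
  note pos = o pos_convex_dist_pos [OF assms(1)] assms(2-4)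
  have "i \<in> {0,1,2,3,4,5}"
    using assms(5) by auto
  then show ?thesis
    by (elim insertE emptyE; simp only: coeffs_eq;
        intro divide_pos_pos mult_pos_pos add_pos_pos zero_less_power pos)
qed

lemma charges_global_min:
  assumes P: "P \<in> linkage_configs a" "pos_convex P" and q: "q1 > 0" "q2 > 0" "q4 > 0"
  shows "charge_s q1 q2 q4 P > 0" "charge_t q1 q2 q4 P > 0"
    "is_global_min a q1 q2 q4 (charge_s q1 q2 q4 P) (charge_t q1 q2 q4 P) P"
proof -
  define s where "s = charge_s q1 q2 q4 P"
  define t where "t = charge_t q1 q2 q4 P"
  define k where "k = coeffs q1 q2 q4 P"
  have k: "k 0 > 0" "k 1 > 0" "k 2 > 0" "k 3 > 0" "k 4 > 0" "k 5 > 0"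
    using coeffs_pos [OF P(2) q] by (simp_all add: k_def)
  note sol = solve_s [OF k]
  have s: "s = solve_s (k 0) (k 1) (k 2) (k 3) (k 4) (k 5)"
    by (simp add: s_def charge_s_def k_def Let_def)
  have t: "t = k 2 / (k 0 + s * k 1)"
    by (simp add: s_def t_def charge_t_def k_def Let_def)
  note sol = sol [folded s, folded t]
  then show "charge_s q1 q2 q4 P > 0" "charge_t q1 q2 q4 P > 0"
    by (simp_all add: s_def t_def)
  have o: "orient P 0 1 2 > 0" "orient P 0 1 4 > 0" "orient P 0 2 3 > 0"
    "orient P 0 2 4 > 0" "orient P 0 3 4 > 0" "orient P 1 2 3 > 0" "orient P 1 2 4 > 0" "orient P 1 3 4 > 0" "orient P 2 3 4 > 0"
    using P(2) unfolding pos_convex_iff by blast+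
  note pos = pos_convex_dist_pos [OF P(2)]
  note k_eq = coeffs_eq [of q1 q2 q4 P, folded k_def]
  \<comment> \<open>With the Coulomb stresses on the diagonals, the two readings of the stress on
    side 23 agree exactly when the first charge equation holds; side 34 gives the second in the same
    way.\<close>
  have "(q1 * t / dist (P 0) (P 2) ^ 3 * orient P 0 1 2 + s * t / dist (P 2) (P 4) ^ 3 * orient P 1 2 4) / orient P 1 2 3
      = t * k 0 + s * t * k 1"
    unfolding k_eq by (simp add: add_divide_distrib mult_ac)
  then have e23: "(q1 * t / dist (P 0) (P 2) ^ 3 * orient P 0 1 2 + s * t / dist (P 2) (P 4) ^ 3 * orient P 1 2 4) / orient P 1 2 3
      = k 2" using sol by simp
  have "(q2 * s / dist (P 1) (P 4) ^ 3 * orient P 0 1 4 + s * t / dist (P 2) (P 4) ^ 3 * orient P 0 2 4) / orient P 0 3 4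
      = s * k 3 + s * t * k 4"
    unfolding k_eq by (simp add: add_divide_distrib mult_ac)
  then have e34: "(q2 * s / dist (P 1) (P 4) ^ 3 * orient P 0 1 4 + s * t / dist (P 2) (P 4) ^ 3 * orient P 0 2 4) / orient P 0 3 4
      = k 5" using sol by simp
  have u: "q1 * t / dist (P 0) (P 2) ^ 3 > 0" "q1 * q4 / dist (P 0) (P 3) ^ 3 > 0" "q2 * q4 / dist (P 1) (P 3) ^ 3 > 0"
    "q2 * s / dist (P 1) (P 4) ^ 3 > 0" "s * t / dist (P 2) (P 4) ^ 3 > 0"
    by (intro divide_pos_pos mult_pos_pos zero_less_power q sol(1,2) pos)+
  obtain W where "\<And>i j. W i j = W j i" "balanced 5 W (\<lambda>i. Re (P i))" "balanced 5 W (\<lambda>i. Im (P i))"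
    "W 0 1 \<ge> 0" "W 0 2 = - (q1 * t / dist (P 0) (P 2) ^ 3)" "W 0 3 = - (q1 * q4 / dist (P 0) (P 3) ^ 3)"
    "W 1 3 = - (q2 * q4 / dist (P 1) (P 3) ^ 3)" "W 1 4 = - (q2 * s / dist (P 1) (P 4) ^ 3)" "W 2 4 = - (s * t / dist (P 2) (P 4) ^ 3)"
    using equilibrium_stress [OF P(2) u e23 [unfolded k_eq] e34 [unfolded k_eq]] by blast
  then show "is_global_min a q1 q2 q4 (charge_s q1 q2 q4 P) (charge_t q1 q2 q4 P) P"
    unfolding s_def [symmetric] t_def [symmetric]
    by (intro equilibrium_is_global_min [OF P q sol(1,2)])
qed

lemma continuous_on_charges:
  assumes cont: "\<And>i. continuous_on S (\<lambda>x. P x i)" and pos: "\<And>x. x \<in> S \<Longrightarrow> pos_convex (P x)"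
    and q: "q1 > 0" "q2 > 0" "q4 > 0"
  shows "continuous_on S (\<lambda>x. charge_s q1 q2 q4 (P x))" "continuous_on S (\<lambda>x. charge_t q1 q2 q4 (P x))"
proof -
  have orient: "continuous_on S (\<lambda>x. orient (P x) i j k)" for i j k
    unfolding orient_expand by (intro continuous_intros cont)
  have dist: "continuous_on S (\<lambda>x. dist (P x i) (P x j) ^ 3)" for i j
    by (intro continuous_intros cont)
  have nz: "orient (P x) 1 2 3 \<noteq> 0" "orient (P x) 0 3 4 \<noteq> 0" "orient (P x) 2 3 4 \<noteq> 0" if "x \<in> S" for x
    using pos [OF that] by (simp_all add: pos_convex_iff)
  have nz': "dist (P x 0) (P x 3) ^ 3 \<noteq> 0" "dist (P x 1) (P x 3) ^ 3 \<noteq> 0" "dist (P x 0) (P x 2) ^ 3 \<noteq> 0"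
    "dist (P x 1) (P x 4) ^ 3 \<noteq> 0" "dist (P x 2) (P x 4) ^ 3 \<noteq> 0" if "x \<in> S" for x
    using pos_convex_dist_pos [OF pos [OF that]] by simp_all
  have k: "continuous_on S (\<lambda>x. coeffs q1 q2 q4 (P x) i)" for i
  proof (cases "i \<in> {0,1,2,3,4,5}")
    case True
    then show ?thesis
      by (elim insertE emptyE; simp only: coeffs_eq;
          intro continuous_on_divide continuous_on_mult continuous_on_add continuous_on_const orient dist ballI nz nz')
  next
    case False
    then show ?thesis
      by (simp add: coeffs_def Let_def)
  qed
  note kpos = coeffs_pos [OF pos q]
  show s: "continuous_on S (\<lambda>x. charge_s q1 q2 q4 (P x))"
    unfolding charge_s_def solve_s_def Let_def
  proof (intro continuous_intros k ballI)
    fix x assume "x \<in> S"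
    then show "2 * (coeffs q1 q2 q4 (P x) 3 * coeffs q1 q2 q4 (P x) 1) \<noteq> 0"
      using kpos [of x 3] kpos [of x 1] by simp
  qed
  show "continuous_on S (\<lambda>x. charge_t q1 q2 q4 (P x))"
    unfolding charge_t_def Let_def
  proof (intro continuous_intros k s ballI)
    fix x assume "x \<in> S"
    \<comment> \<open>Every pentagon is a configuration of the linkage with its own side lengths,
      which makes the positivity of the charge available.\<close>
    have "P x \<in> linkage_configs (\<lambda>i. dist (P x i) (P x ((i + 1) mod 5)))"
      by (simp add: linkage_configs_def)
    then have "charge_s q1 q2 q4 (P x) > 0"
      using pos [OF \<open>x \<in> S\<close>] q by (rule charges_global_min)
    then have "coeffs q1 q2 q4 (P x) 0 + charge_s q1 q2 q4 (P x) * coeffs q1 q2 q4 (P x) 1 > 0"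
      using kpos [OF \<open>x \<in> S\<close>, of 0] kpos [OF \<open>x \<in> S\<close>, of 1] by (simp add: add_pos_pos)
    then show "coeffs q1 q2 q4 (P x) 0 + charge_s q1 q2 q4 (P x) * coeffs q1 q2 q4 (P x) 1 \<noteq> 0"
      by simp
  qed
qed

section \<open>The path of configurations and charges\<close>

theorem theorem4:
  fixes a :: "nat \<Rightarrow> real" and q1 q2 q4 :: real and P0 P1 :: pentagon
  assumes "\<forall>i<5. a i > 0"
    and "q1 > 0" and "q2 > 0" and "q4 > 0"
    and "P0 \<in> convex_configs a" and "P1 \<in> convex_configs a"
  shows "\<exists>(s :: real \<Rightarrow> real) (t :: real \<Rightarrow> real) (P :: real \<Rightarrow> pentagon).
           continuous_on {0..1} s \<and> continuous_on {0..1} t \<and>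
           (\<forall>\<tau>\<in>{0..1}. s \<tau> > 0 \<and> t \<tau> > 0) \<and>
           (\<forall>i<5. \<forall>j<5. continuous_on {0..1} (\<lambda>\<tau>. dist (P \<tau> i) (P \<tau> j))) \<and>
           (\<forall>\<tau>\<in>{0..1}. P \<tau> \<in> convex_configs a) \<and>
           congruent_pent (P 0) P0 \<and> congruent_pent (P 1) P1 \<and>
           (\<forall>\<tau>\<in>{0..1}. is_global_min a q1 q2 q4 (s \<tau>) (t \<tau>) (P \<tau>))"
proof -
  note q = assms(2-4)
  obtain z0 where z0: "z0 \<in> region a" "congruent_pent (pent a z0) P0"
    using convex_configs_pent [OF assms(1,5)] .
  obtain z1 where z1: "z1 \<in> region a" "congruent_pent (pent a z1) P1"
    using convex_configs_pent [OF assms(1,6)] .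
  obtain g where g: "path g" "path_image g \<subseteq> region a" "pathstart g = z0" "pathfinish g = z1"
    using path_connected_region [OF assms(1)] z0(1) z1(1) unfolding path_connected_def by meson
  \<comment> \<open>In the fixed frame of \<open>pent\<close> the vertices themselves move
    continuously. The mutual distances, which do not depend on the representative of a point of
    M(L), then do so as well.\<close>
  define P where "P \<tau> = pent a (g \<tau>)" for \<tau>
  have g_region: "g \<tau> \<in> region a" if "\<tau> \<in> {0..1}" for \<tau>
    using g(2) that by (auto simp: path_image_def)
  have P: "P \<tau> \<in> linkage_configs a" "pos_convex (P \<tau>)" if "\<tau> \<in> {0..1}" for \<tau>
    using pent_convex [OF assms(1), of "fst (g \<tau>)" "snd (g \<tau>)"] g_region [OF that] by (simp_all add: P_def)
  have cont: "continuous_on {0..1} (\<lambda>\<tau>. P \<tau> i)" for i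
    unfolding P_def
    using continuous_on_compose2 [OF continuous_on_pent [OF assms(1)] g(1) [unfolded path_def], of i] g_region by blast
  show ?thesis
  proof (intro exI conjI ballI allI impI)
    show "continuous_on {0..1} (\<lambda>\<tau>. charge_s q1 q2 q4 (P \<tau>))" "continuous_on {0..1} (\<lambda>\<tau>. charge_t q1 q2 q4 (P \<tau>))"
      by (rule continuous_on_charges [OF cont P(2) q]; assumption)+
    show "congruent_pent (P 0) P0" "congruent_pent (P 1) P1"
      using z0 z1 g by (simp_all add: P_def pathstart_def pathfinish_def)
    show "continuous_on {0..1} (\<lambda>\<tau>. dist (P \<tau> i) (P \<tau> j))" for i j
      by (intro continuous_intros cont)
    fix \<tau> :: real assume \<tau>: "\<tau> \<in> {0..1}"
    show "P \<tau> \<in> convex_configs a"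
      using P [OF \<tau>] by (simp add: convex_configs_def strictly_convex_pent_iff)
    show "charge_s q1 q2 q4 (P \<tau>) > 0" "charge_t q1 q2 q4 (P \<tau>) > 0"
      "is_global_min a q1 q2 q4 (charge_s q1 q2 q4 (P \<tau>)) (charge_t q1 q2 q4 (P \<tau>)) (P \<tau>)"
      using charges_global_min [OF P [OF \<tau>] q] .
  qed
qed

end
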